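(* Let $\Omega\subset\mathbb R^n$ be open, $t_1<t_2$, and let $f$ be continuous on $\Omega\times(t_1,t_2)$. Let $\psi:(0,\infty)\to(0,\infty)$ satisfy $\lim_{\varepsilon\to0}\psi(\varepsilon)=\infty$ and $\lim_{\varepsilon\to0}\varepsilon\,\psi(\varepsilon)=0$. A function $u\in C(\Omega\times(t_1,t_2))$ that is convex in the spatial variable is a viscosity solution of $$\frac{\partial u}{\partial t}(x,t)=\big(\det D^2u(x,t)\big)^{1/n}+f(x,t)\quad\text{in }\Omega\times(t_1,t_2)$$ if and only if $$u(x,t)=\inf_{\substack{\det A=1\\ A\le \psi(\varepsilon)I}}\left\{\frac{1}{\frac{n}{n+2}\varepsilon^2}\int_{t-\frac{n}{n+2}\varepsilon^2}^{t}\frac{1}{|B_\varepsilon(0)|}\int_{B_\varepsilon(0)}u(x+Ay,s)\,dy\,ds\right\}+\frac{n}{2(n+2)}f(x,t)\,\varepsilon^2+o(\varepsilon^2)\quad\text{as }\varepsilon\to0,$$ for $x\in\Omega$, $t\in(t_1,t_2)$, in the viscosity sense.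
   Context: The infimum is over symmetric positive definite $n\times n$ matrices $A$; $A\le\theta I$ means $\theta I-A$ is positive semidefinite. $C^{2,1}$ denotes functions twice continuously differentiable in $x$ and continuously differentiable in $t$. For a constant $c$ and function $g$, "$c\le g(\varepsilon)+o(\varepsilon^2)$" means $\lim_{\varepsilon\to0}[c-g(\varepsilon)]^+/\varepsilon^2=0$ and "$c\ge g(\varepsilon)+o(\varepsilon^2)$" means $\lim_{\varepsilon\to0}[c-g(\varepsilon)]^-/\varepsilon^2=0$. Viscosity solution: a continuous $u$, convex in $x$, is a viscosity solution of $\partial_t u=(\det D^2u)^{1/n}+f$ if for every $(x,t)\in\Omega\times(t_1,t_2)$ and every $\phi\in C^{2,1}$ convex in the spatial variable: (i) if $u-\phi$ has a strict local maximum at $(x,t)$ with $u(x,t)=\phi(x,t)$, then $\partial_t\phi(x,t)-(\det D^2\phi(x,t))^{1/n}\le f(x,t)$; (ii) if $u-\phi$ has a strict local minimum at $(x,t)$ with $u(x,t)=\phi(x,t)$, then $\partial_t\phi(x,t)-(\det D^2\phi(x,t))^{1/n}\ge f(x,t)$. Asymptotic formula in the viscosity sense: writing the formula as $u(x,t)=M_\varepsilon[u](x,t)+o(\varepsilon^2)$ where $M_\varepsilon[v](x,t)$ denotes the right-hand side expression (infimum of averages plus the $f$ term), it holds in the viscosity sense if for every $(x,t)$ and every $\phi\in C^{2,1}$ convex in the spatial variable: (i) if $u-\phi$ has a strict local minimum at $(x,t)$ with $u(x,t)=\phi(x,t)$, then $0\ge-\phi(x,t)+M_\varepsilon[\phi](x,t)+o(\varepsilon^2)$;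 (ii) if $u-\phi$ has a strict local maximum at $(x,t)$ with $u(x,t)=\phi(x,t)$, then $0\le-\phi(x,t)+M_\varepsilon[\phi](x,t)+o(\varepsilon^2)$. *)

theory Defs
  imports "HOL-Analysis.Analysis"
begin

definition spd :: "real^'n^'n \<Rightarrow> bool" where
  "spd A \<longleftrightarrow> transpose A = A \<and> (\<forall>v. v \<noteq> 0 \<longrightarrow> v \<bullet> (A *v v) > 0)"

definition mat_le_scalar :: "real^'n^'n \<Rightarrow> real \<Rightarrow> bool" where
  "mat_le_scalar A \<theta> \<longleftrightarrow> (\<forall>v. v \<bullet> (A *v v) \<le> \<theta> * (v \<bullet> v))"

definition convex_in_space :: "(real^'n) set \<Rightarrow> real \<Rightarrow> real \<Rightarrow> (real^'n \<Rightarrow> real \<Rightarrow> real) \<Rightarrow> bool" where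
  "convex_in_space \<Omega> t1 t2 u \<longleftrightarrow>
     (\<forall>t\<in>{t1<..<t2}. \<forall>C. convex C \<and> C \<subseteq> \<Omega> \<longrightarrow> convex_on C (\<lambda>x. u x t))"

definition C21_convex_test ::
  "(real^'n \<Rightarrow> real \<Rightarrow> real) \<Rightarrow> (real^'n \<Rightarrow> real \<Rightarrow> real^'n) \<Rightarrow>
   (real^'n \<Rightarrow> real \<Rightarrow> real^'n^'n) \<Rightarrow> (real^'n \<Rightarrow> real \<Rightarrow> real) \<Rightarrow> bool" where
  "C21_convex_test \<phi> D\<phi> D2\<phi> \<phi>t \<longleftrightarrow>
     (\<forall>x t. ((\<lambda>y. \<phi> y t) has_derivative (\<lambda>h. D\<phi> x t \<bullet> h)) (at x)) \<and>
     (\<forall>x t. ((\<lambda>y. D\<phi> y t) has_derivative (\<lambda>h. D2\<phi> x t *v h)) (at x)) \<and>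
     (\<forall>x t. ((\<lambda>s. \<phi> x s) has_real_derivative \<phi>t x t) (at t)) \<and>
     continuous_on UNIV (\<lambda>(x, t). \<phi> x t) \<and>
     continuous_on UNIV (\<lambda>(x, t). D\<phi> x t) \<and>
     continuous_on UNIV (\<lambda>(x, t). D2\<phi> x t) \<and>
     continuous_on UNIV (\<lambda>(x, t). \<phi>t x t) \<and>
     (\<forall>t. convex_on UNIV (\<lambda>x. \<phi> x t))"

definition strict_loc_max ::
  "(real^'n) set \<Rightarrow> real \<Rightarrow> real \<Rightarrow> (real^'n \<Rightarrow> real \<Rightarrow> real) \<Rightarrow> (real^'n \<Rightarrow> real \<Rightarrow> real) \<Rightarrow>
   real^'n \<Rightarrow> real \<Rightarrow> bool" where
  "strict_loc_max \<Omega> t1 t2 w \<phi> x t \<longleftrightarrow>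
     (\<exists>r>0. \<forall>y s. y \<in> \<Omega> \<and> s \<in> {t1<..<t2} \<and> norm (y - x) < r \<and> \<bar>s - t\<bar> < r \<and> (y, s) \<noteq> (x, t)
        \<longrightarrow> w y s - \<phi> y s < w x t - \<phi> x t)"

definition strict_loc_min ::
  "(real^'n) set \<Rightarrow> real \<Rightarrow> real \<Rightarrow> (real^'n \<Rightarrow> real \<Rightarrow> real) \<Rightarrow> (real^'n \<Rightarrow> real \<Rightarrow> real) \<Rightarrow>
   real^'n \<Rightarrow> real \<Rightarrow> bool" where
  "strict_loc_min \<Omega> t1 t2 w \<phi> x t \<longleftrightarrow>
     (\<exists>r>0. \<forall>y s. y \<in> \<Omega> \<and> s \<in> {t1<..<t2} \<and> norm (y - x) < r \<and> \<bar>s - t\<bar> < r \<and> (y, s) \<noteq> (x, t)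
        \<longrightarrow> w y s - \<phi> y s > w x t - \<phi> x t)"

definition visc_solution ::
  "(real^'n) set \<Rightarrow> real \<Rightarrow> real \<Rightarrow> (real^'n \<Rightarrow> real \<Rightarrow> real) \<Rightarrow> (real^'n \<Rightarrow> real \<Rightarrow> real) \<Rightarrow> bool" where
  "visc_solution \<Omega> t1 t2 f u \<longleftrightarrow>
     (\<forall>x\<in>\<Omega>. \<forall>t\<in>{t1<..<t2}. \<forall>\<phi> D\<phi> D2\<phi> \<phi>t. C21_convex_test \<phi> D\<phi> D2\<phi> \<phi>t \<longrightarrow>
        ((strict_loc_max \<Omega> t1 t2 u \<phi> x t \<and> u x t = \<phi> x t \<longrightarrow>
            \<phi>t x t - root CARD('n) (det (D2\<phi> x t)) \<le> f x t) \<and>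
         (strict_loc_min \<Omega> t1 t2 u \<phi> x t \<and> u x t = \<phi> x t \<longrightarrow>
            \<phi>t x t - root CARD('n) (det (D2\<phi> x t)) \<ge> f x t)))"

definition M_eps ::
  "(real \<Rightarrow> real) \<Rightarrow> (real^'n \<Rightarrow> real \<Rightarrow> real) \<Rightarrow> real \<Rightarrow> (real^'n \<Rightarrow> real \<Rightarrow> real) \<Rightarrow>
   real^'n \<Rightarrow> real \<Rightarrow> real" where
  "M_eps \<psi> f \<epsilon> v x t =
     (let n = real CARD('n); \<tau> = n / (n + 2) * \<epsilon>\<^sup>2 in
      Inf ((\<lambda>A::real^'n^'n. (1 / \<tau>) *
              integral {t - \<tau>..t} (\<lambda>s. (1 / measure lebesgue (ball (0::real^'n) \<epsilon>)) *
                 integral (ball 0 \<epsilon>) (\<lambda>y. v (x + A *v y) s)))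
           ` {A. spd A \<and> det A = 1 \<and> mat_le_scalar A (\<psi> \<epsilon>)})
      + n / (2 * (n + 2)) * f x t * \<epsilon>\<^sup>2)"

definition asymp_visc ::
  "(real^'n) set \<Rightarrow> real \<Rightarrow> real \<Rightarrow> (real \<Rightarrow> real) \<Rightarrow> (real^'n \<Rightarrow> real \<Rightarrow> real) \<Rightarrow>
   (real^'n \<Rightarrow> real \<Rightarrow> real) \<Rightarrow> bool" where
  "asymp_visc \<Omega> t1 t2 \<psi> f u \<longleftrightarrow>
     (\<forall>x\<in>\<Omega>. \<forall>t\<in>{t1<..<t2}. \<forall>\<phi> D\<phi> D2\<phi> \<phi>t. C21_convex_test \<phi> D\<phi> D2\<phi> \<phi>t \<longrightarrow>
        ((strict_loc_min \<Omega> t1 t2 u \<phi> x t \<and> u x t = \<phi> x t \<longrightarrow>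
            ((\<lambda>\<epsilon>. max 0 (- \<phi> x t + M_eps \<psi> f \<epsilon> \<phi> x t) / \<epsilon>\<^sup>2) \<longlongrightarrow> 0) (at_right 0)) \<and>
         (strict_loc_max \<Omega> t1 t2 u \<phi> x t \<and> u x t = \<phi> x t \<longrightarrow>
            ((\<lambda>\<epsilon>. max 0 (\<phi> x t - M_eps \<psi> f \<epsilon> \<phi> x t) / \<epsilon>\<^sup>2) \<longlongrightarrow> 0) (at_right 0))))"

end

theory Submission
  imports Defs
begin

text \<open>
  For every convex \<open>C\<^sup>2\<^sup>,\<^sup>1\<close> function \<open>\<phi>\<close>, whether or not it touches \<open>u\<close>,
  the quotient \<open>(M\<^sub>\<epsilon>[\<phi>] - \<phi>) / \<epsilon>\<^sup>2\<close> converges to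
  \<open>n / (2(n+2)) ((det D\<^sup>2\<phi>)\<^sup>1\<^sup>/\<^sup>n - \<phi>\<^sub>t + f)\<close>, so the two notions agree test function by
  test function. Averaging the second-order Taylor expansion of \<open>\<phi>(x + Ay, s)\<close> over the ball
  gives \<open>\<epsilon>\<^sup>2 / (2(n+2)) tr(A\<^sup>T D\<^sup>2\<phi> A)\<close>, averaging in time gives \<open>- n\<epsilon>\<^sup>2 / (2(n+2)) \<phi>\<^sub>t\<close>, and by
  the arithmetic-geometric mean inequality for eigenvalues the infimum of \<open>tr(A\<^sup>T H A)\<close> over
  \<open>det A = 1\<close> is \<open>n (det H)\<^sup>1\<^sup>/\<^sup>n\<close>.
\<close>

section \<open>Moments of the ball\<close>

text \<open>The obstacle is uniformity: the expansion must hold for all matrices of the infimum,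
  whose norms may reach \<open>\<psi> \<epsilon>\<close>, a bound that tends to infinity. Therefore
  the two inequalities are proved differently. The lower one treats all matrices at once; the limit
  of \<open>\<epsilon> * \<psi> \<epsilon>\<close> keeps the points \<open>x + A *v y\<close> near
  \<open>x\<close>. The upper one uses a single matrix fixed beforehand, which is allowed for small
  \<open>\<epsilon>\<close> because \<open>\<psi>\<close> tends to infinity; it is only a near
  minimiser of the trace, since for a singular Hessian the infimum need not be attained. The Taylor
  polynomial is taken at \<open>(x, s)\<close>, and only the Hessian is frozen at
  \<open>(x, t)\<close>. The gradient at time \<open>s\<close> then integrates to zero over the ball
  for each \<open>s\<close>, so its variation in time never has to be estimated. The length
  \<open>n / (n + 2) * \<epsilon>\<^sup>2\<close> of the time interval is tuned so that the factor
  \<open>n\<close> of the arithmetic-geometric mean inequality also stands before the time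
  derivative, and both terms get the same weight.\<close>

lemma set_integrable_ball_continuous:
  fixes g :: "'a::euclidean_space \<Rightarrow> real"
  assumes "continuous_on UNIV g"
  shows "set_integrable lborel (ball 0 r) g"
proof (rule set_integrable_subset)
  show "set_integrable lborel (cball 0 r) g"
    unfolding set_integrable_def
    by (intro borel_integrable_compact compact_cball continuous_on_subset[OF assms]) auto
qed auto

lemma integrable_on_ball_continuous:
  fixes g :: "'a::euclidean_space \<Rightarrow> real"
  assumes "continuous_on UNIV g"
  shows "g integrable_on ball 0 r"
  by (rule set_borel_integral_eq_integral(1)[OF set_integrable_ball_continuous[OF assms]])

lemma integral_ball_eq_LINT:
  fixes g :: "'a::euclidean_space \<Rightarrow> real"
  assumes "continuous_on UNIV g"
  shows "integral (ball 0 r) g = (\<integral>y. indicator (ball 0 r) y * g y \<partial>lborel)"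
  using set_borel_integral_eq_integral(2)[OF set_integrable_ball_continuous[OF assms], of r]
  by (simp add: set_lebesgue_integral_def)

text \<open>Change of variables: \<open>T\<close> preserves the measure and, as it preserves norms,
  the indicator of the ball. It is meant for reflections and permutations of coordinates.\<close>

lemma integral_ball_measure_preserving_isometry:
  fixes g :: "'a::euclidean_space \<Rightarrow> real"
  assumes g: "continuous_on UNIV g" and T: "continuous_on UNIV T"
    and "distr lborel borel T = (lborel :: 'a measure)" and norm: "\<And>y. norm (T y) = norm y"
  shows "integral (ball 0 r) (\<lambda>y. g (T y)) = integral (ball 0 r) g"
proof -
  have [measurable]: "T \<in> borel_measurable borel" "g \<in> borel_measurable borel"
    using T g by (simp_all add: borel_measurable_continuous_onI)
  have "integral (ball 0 r) g = (\<integral>y. indicator (ball 0 r) y * g y \<partial>distr lborel borel T)"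
    using assms by (simp add: integral_ball_eq_LINT)
  also have "\<dots> = (\<integral>y. indicator (ball 0 r) (T y) * g (T y) \<partial>lborel)"
    by (rule integral_distr) (auto intro!: borel_measurable_times borel_measurable_indicator)
  also have "\<dots> = (\<integral>y. indicator (ball 0 r) y * g (T y) \<partial>lborel)"
    by (simp add: indicator_def norm)
  also have "\<dots> = integral (ball 0 r) (\<lambda>y. g (T y))"
    by (intro integral_ball_eq_LINT[symmetric] continuous_on_compose2[OF g T]) auto
  finally show ?thesis by simp
qed

section \<open>Coordinate symmetries of Lebesgue measure\<close>

lemma continuous_on_vec_mult_permute:
  fixes c :: "'n::finite \<Rightarrow> real" and \<sigma> :: "'n \<Rightarrow> 'n"
  shows "continuous_on UNIV (\<lambda>y::real^'n. \<chi> k. c k * y $ \<sigma> k)"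
  by (intro continuous_intros)

lemma norm_signed_permutation:
  fixes c :: "'n::finite \<Rightarrow> real" and \<sigma> :: "'n \<Rightarrow> 'n"
  assumes "bij \<sigma>" and c: "\<And>k. \<bar>c k\<bar> = 1"
  shows "norm ((\<chi> k. c k * y $ \<sigma> k) :: real^'n) = norm (y :: real^'n)"
proof -
  have "(\<Sum>k\<in>UNIV. (c k * y $ \<sigma> k)\<^sup>2) = (\<Sum>k\<in>UNIV. (y $ \<sigma> k)\<^sup>2)"
    using c by (intro sum.cong) (auto simp: power_mult_distrib abs_square_eq_1)
  also have "\<dots> = (\<Sum>k\<in>UNIV. (y $ k)\<^sup>2)"
    by (rule sum.reindex_bij_betw[OF assms(1)])
  finally show ?thesis by (simp add: norm_vec_def L2_set_def)
qed

text \<open>Lebesgue measure is determined by its values on boxes. The preimage of a box is the box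
  with sides rearranged by \<open>inv \<sigma>\<close>, and the product of the side lengths does not
  see the order.\<close>

lemma distr_lborel_permute_coordinates:
  fixes \<sigma> :: "'n::finite \<Rightarrow> 'n"
  assumes \<sigma>: "bij \<sigma>"
  shows "distr lborel borel (\<lambda>y. \<chi> k. y $ \<sigma> k) = (lborel :: (real^'n) measure)"
proof (rule lborel_eqI[symmetric])
  let ?T = "\<lambda>y. (\<chi> k. y $ \<sigma> k) :: real^'n"
  have [measurable]: "?T \<in> borel_measurable borel"
    using continuous_on_vec_mult_permute[of "\<lambda>_. 1" \<sigma>]
    by (intro borel_measurable_continuous_onI) simp
  fix l u :: "real^'n"
  assume lu: "\<And>b. b \<in> Basis \<Longrightarrow> l \<bullet> b \<le> u \<bullet> b"
  have lu': "l $ k \<le> u $ k" for k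
    using lu[of "axis k 1"] by (simp add: inner_axis)
  let ?i = "inv \<sigma>"
  have bi: "bij ?i" using \<sigma> by (rule bij_imp_bij_inv)
  have inv1: "\<sigma> (?i k) = k" "?i (\<sigma> k) = k" for k
    using \<sigma> by (simp_all add: bij_is_surj surj_f_inv_f bij_is_inj)
  have "?T -` box l u = box (\<chi> k. l $ ?i k) (\<chi> k. u $ ?i k)"
    by (auto simp: mem_box_cart inv1) (metis inv1)+
  then have "emeasure (distr lborel borel ?T) (box l u) =
      emeasure lborel (box (\<chi> k. l $ ?i k) (\<chi> k. u $ ?i k) :: (real^'n) set)"
    by (subst emeasure_distr) auto
  also have "\<dots> = ennreal (\<Prod>b\<in>Basis. ((\<chi> k. u $ ?i k) - (\<chi> k. l $ ?i k)) \<bullet> b)"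
    using lu' by (intro emeasure_lborel_box) (auto simp: Basis_vec_def inner_axis)
  also have "(\<Prod>b\<in>Basis. ((\<chi> k. u $ ?i k) - (\<chi> k. l $ ?i k)) \<bullet> b) = (\<Prod>k\<in>UNIV. (u - l) $ ?i k)"
    by (simp add: Basis_vec_def UNION_singleton_eq_range)
       (subst prod.reindex, auto simp: inj_on_def axis_eq_axis inner_axis)
  also have "\<dots> = (\<Prod>k\<in>UNIV. (u - l) $ k)"
    by (rule prod.reindex_bij_betw[OF bi])
  also have "\<dots> = (\<Prod>b\<in>Basis. (u - l) \<bullet> b)"
    by (simp add: Basis_vec_def UNION_singleton_eq_range)
       (subst prod.reindex, auto simp: inj_on_def axis_eq_axis inner_axis)
  finally show "emeasure (distr lborel borel ?T) (box l u) = (\<Prod>b\<in>Basis. (u - l) \<bullet> b)" .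
qed simp

lemma distr_lborel_sign_change:
  fixes c :: "'n::finite \<Rightarrow> real"
  assumes c: "\<And>k. \<bar>c k\<bar> = 1"
  shows "distr lborel borel (\<lambda>y. \<chi> k. c k * y $ k) = (lborel :: (real^'n) measure)"
proof -
  \<comment> \<open>\<open>lborel_affine_euclidean\<close> indexes scaling factors by basis vectors,
    so \<open>c\<close> is carried over from indices to the vectors \<open>axis k 1\<close>. Outside
    the basis \<open>SOME\<close> still yields some index, so that all values of \<open>d\<close>
    have absolute value 1.\<close>
  define d where "d b = c (SOME k. b = axis k (1::real))" for b :: "real^'n"
  have d: "d (axis k 1) = c k" for k
    by (auto simp: d_def axis_eq_axis)
  have T: "(\<lambda>x. 0 + (\<Sum>j\<in>Basis. (d j * (x \<bullet> j)) *\<^sub>R j)) = (\<lambda>y::real^'n. \<chi> k. c k * y $ k)"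
  proof (rule ext)
    fix x :: "real^'n"
    have "(\<Sum>j\<in>Basis. (d j * (x \<bullet> j)) *\<^sub>R j) =
        (\<Sum>k\<in>UNIV. (d (axis k 1) * (x \<bullet> axis k 1)) *\<^sub>R axis k 1)"
      by (simp add: Basis_vec_def UNION_singleton_eq_range)
         (subst sum.reindex, auto simp: inj_on_def axis_eq_axis)
    also have "\<dots> = (\<chi> k. c k * x $ k)"
      by (simp add: d inner_axis) (simp add: vec_eq_iff axis_def if_distrib cong: if_cong)
    finally show "0 + (\<Sum>j\<in>Basis. (d j * (x \<bullet> j)) *\<^sub>R j) = (\<chi> k. c k * x $ k)" by simp
  qed
  have d1: "\<bar>d j\<bar> = 1" for j using c by (simp add: d_def)
  then have "d j \<noteq> 0" for j by (metis abs_zero zero_neq_one)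
  then have "(lborel :: (real^'n) measure) =
      density (distr lborel borel (\<lambda>x. 0 + (\<Sum>j\<in>Basis. (d j * (x \<bullet> j)) *\<^sub>R j))) (\<lambda>_. \<Prod>j\<in>Basis. \<bar>d j\<bar>)"
    by (intro lborel_affine_euclidean) auto
  then show ?thesis unfolding T by (simp add: d1 density_1)
qed

text \<open>The reflection of coordinate \<open>i\<close> preserves the integral and also reverses
  its sign.\<close>

lemma integral_ball_sign_change_zero:
  fixes g :: "real^'n \<Rightarrow> real"
  assumes g: "continuous_on UNIV g" 
    and odd: "\<And>y. g (\<chi> k. (if k = i then -1 else 1) * y $ k) = - g y"
  shows "integral (ball 0 r) g = 0"
proof -
  let ?T = "\<lambda>y. (\<chi> k. (if k = i then -1 else 1) * y $ k) :: real^'n"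
  have "integral (ball 0 r) (\<lambda>y. g (?T y)) = integral (ball 0 r) g"
    using continuous_on_vec_mult_permute[of "\<lambda>k. if k = i then -1 else 1" id]
      norm_signed_permutation[of id "\<lambda>k. if k = i then -1 else 1"]
    by (intro integral_ball_measure_preserving_isometry g distr_lborel_sign_change) auto
  then show ?thesis by (simp add: odd)
qed

lemma integral_ball_coordinate:
  "integral (ball 0 r) (\<lambda>y::real^'n. y $ i) = 0"
  by (rule integral_ball_sign_change_zero[of _ i]) (auto intro!: continuous_intros)

lemma integral_ball_mixed_coordinates:
  assumes "i \<noteq> j"
  shows "integral (ball 0 r) (\<lambda>y::real^'n. y $ i * y $ j) = 0"
  using assms by (intro integral_ball_sign_change_zero[of _ i]) (auto intro!: continuous_intros)

lemma integral_ball_coordinate_square_eq: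
  "integral (ball 0 r) (\<lambda>y::real^'n. (y $ i)\<^sup>2) = integral (ball 0 r) (\<lambda>y::real^'n. (y $ j)\<^sup>2)"
proof -
  define \<sigma> where "\<sigma> = id(i := j, j := i)"
  have \<sigma>: "bij \<sigma>"
    by (rule o_bij[of \<sigma>]) (auto simp: \<sigma>_def fun_eq_iff)
  have "integral (ball 0 r) (\<lambda>y. ((\<chi> k. y $ \<sigma> k) $ j :: real)\<^sup>2) = integral (ball 0 r) (\<lambda>y::real^'n. (y $ j)\<^sup>2)"
    using continuous_on_vec_mult_permute[of "\<lambda>_. 1" \<sigma>] norm_signed_permutation[OF \<sigma>, of "\<lambda>_. 1"]
    by (intro integral_ball_measure_preserving_isometry[where g = "\<lambda>y. (y $ j)\<^sup>2"] 
        distr_lborel_permute_coordinates \<sigma>) (auto intro!: continuous_intros)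
  then show ?thesis by (simp add: \<sigma>_def)
qed

section \<open>Scaling and second moments\<close>

lemma integral_ball_scale:
  fixes g :: "'a::euclidean_space \<Rightarrow> real"
  assumes g: "continuous_on UNIV g" and q: "q > 0"
  shows "integral (ball 0 q) g = q ^ DIM('a) * integral (ball 0 1) (\<lambda>y. g (q *\<^sub>R y))"
proof -
  have [measurable]: "g \<in> borel_measurable borel"
    using g by (simp add: borel_measurable_continuous_onI)
  have [measurable]: "(\<lambda>y. indicator (ball 0 q) y * g y) \<in> borel_measurable borel"
    by (auto intro!: borel_measurable_times borel_measurable_indicator)
  have gq: "continuous_on UNIV (\<lambda>y. g (q *\<^sub>R y))"
    by (intro continuous_on_compose2[OF g] continuous_intros) auto
  have "integral (ball 0 q) g = (\<integral>y. indicator (ball 0 q) y * g y 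
      \<partial>density (distr lborel borel (\<lambda>x. 0 + q *\<^sub>R x)) (\<lambda>_. ennreal (q ^ DIM('a))))"
    using q lborel_affine[of q "0::'a"] by (simp add: integral_ball_eq_LINT g ennreal_power)
  also have "\<dots> = (\<integral>y. q ^ DIM('a) *\<^sub>R (indicator (ball 0 q) (q *\<^sub>R y) * g (q *\<^sub>R y)) \<partial>lborel)"
    using q integral_distr[of "\<lambda>y. q *\<^sub>R y" lborel borel "\<lambda>y. indicator (ball 0 q) y * g y :: real"]
    by (subst integral_density) auto
  also have "\<dots> = q ^ DIM('a) * (\<integral>y. indicator (ball 0 1) y * g (q *\<^sub>R y) \<partial>lborel)"
    using q by (simp add: indicator_def)
  also have "\<dots> = q ^ DIM('a) * integral (ball 0 1) (\<lambda>y. g (q *\<^sub>R y))"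
    using integral_ball_eq_LINT[OF gq] by simp
  finally show ?thesis .
qed

text \<open>Only the sign on the shell matters. This freedom is used for the integrand
  \<open>(norm y)\<^sup>2 - q\<^sup>2\<close>, which is negative inside the smaller ball.\<close>

lemma integral_ball_mono_radius:
  fixes g :: "'a::euclidean_space \<Rightarrow> real"
  assumes g: "continuous_on UNIV g" and "q \<le> r"
    and nonneg: "\<And>y. q \<le> norm y \<Longrightarrow> norm y < r \<Longrightarrow> 0 \<le> g y"
  shows "integral (ball 0 q) g \<le> integral (ball 0 r) g"
  unfolding integral_ball_eq_LINT[OF g]
  using set_integrable_ball_continuous[OF g] assms
  by (intro integral_mono) (auto simp: set_integrable_def indicator_def)

text \<open>Compare the unit ball with the ball of radius \<open>q < 1\<close>, where both the volume and the second
  moment are known by scaling, divide by \<open>1 - q\<close> and let \<open>q\<close> tend to \<open>1\<close>.\<close>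

lemma integral_unit_ball_norm_square:
  "integral (ball 0 1) (\<lambda>y::'a::euclidean_space. (norm y)\<^sup>2) =
     real DIM('a) / (real DIM('a) + 2) * measure lebesgue (ball (0::'a) 1)"
proof -
  define n where "n = DIM('a)"
  define I where "I = integral (ball 0 1) (\<lambda>y::'a. (norm y)\<^sup>2)"
  define V where "V = measure lebesgue (ball (0::'a) 1)"
  have const: "integral (ball 0 q) (\<lambda>y::'a. c) = c * (q ^ n * V)" if "q > 0" for q c :: real
  proof -
    have "integral (ball 0 q) (\<lambda>y::'a. c) = c * integral (ball 0 q) (\<lambda>y::'a. 1)"
      by (simp flip: integral_mult_right)
    also have "integral (ball 0 q) (\<lambda>y::'a. 1) = q ^ n * integral (ball 0 1) (\<lambda>y::'a. 1)"
      using that unfolding n_def by (intro integral_ball_scale) auto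
    also have "integral (ball 0 1) (\<lambda>y::'a. 1) = V"
      unfolding V_def by (rule lmeasure_integral[symmetric]) simp
    finally show ?thesis .
  qed
  have sq: "integral (ball 0 q) (\<lambda>y::'a. (norm y)\<^sup>2) = q ^ (n + 2) * I" if "q > 0" for q
  proof -
    have "integral (ball 0 q) (\<lambda>y::'a. (norm y)\<^sup>2) = q ^ n * integral (ball 0 1) (\<lambda>y::'a. (norm (q *\<^sub>R y))\<^sup>2)"
      using that unfolding n_def by (intro integral_ball_scale) (auto intro!: continuous_intros)
    also have "integral (ball 0 1) (\<lambda>y::'a. (norm (q *\<^sub>R y))\<^sup>2) = q\<^sup>2 * I"
      by (simp add: power_mult_distrib I_def)
    finally show ?thesis by (simp add: power_add power2_eq_square)
  qed
  have diff: "integral (ball 0 q) (\<lambda>y::'a. (norm y)\<^sup>2 - c) = q ^ (n + 2) * I - c * (q ^ n * V)"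
    if "q > 0" for q c
    using that const[of q c] sq[of q]
    by (subst integral_diff) (auto intro!: integrable_on_ball_continuous continuous_intros)
  have geo: "1 - q ^ m = (1 - q) * (\<Sum>k<m. q ^ k)" for q :: real and m
    by (rule one_diff_power_eq)
  \<comment> \<open>On the shell \<open>(norm y)\<^sup>2\<close> lies between
    \<open>q\<^sup>2\<close> and 1, so \<open>1 - (norm y)\<^sup>2\<close> and
    \<open>(norm y)\<^sup>2 - q\<^sup>2\<close> are both nonnegative there. The geometric sums make
    the factor \<open>1 - q\<close> explicit; after cancelling it, the sums tend to \<open>n\<close>
    and \<open>n + 2\<close>.\<close>
  have bounds: "I * (\<Sum>k<n+2. q ^ k) \<le> V * (\<Sum>k<n. q ^ k)" "q\<^sup>2 * V * (\<Sum>k<n. q ^ k) \<le> I * (\<Sum>k<n+2. q ^ k)"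
    if q: "0 < q" "q < 1" for q
  proof -
    have "integral (ball 0 q) (\<lambda>y::'a. - ((norm y)\<^sup>2 - 1)) \<le> integral (ball 0 1) (\<lambda>y::'a. - ((norm y)\<^sup>2 - 1))"
      using q by (intro integral_ball_mono_radius) (auto intro!: continuous_intros simp: abs_square_le_1)
    then have "I - V \<le> q ^ (n + 2) * I - q ^ n * V"
      unfolding integral_neg using q by (simp add: diff)
    then have "I * (1 - q ^ (n + 2)) \<le> V * (1 - q ^ n)"
      by (simp add: algebra_simps)
    then have "(1 - q) * (I * (\<Sum>k<n+2. q ^ k)) \<le> (1 - q) * (V * (\<Sum>k<n. q ^ k))"
      unfolding geo by (simp only: mult_ac)
    with q show "I * (\<Sum>k<n+2. q ^ k) \<le> V * (\<Sum>k<n. q ^ k)"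
      by (simp only: mult_le_cancel_left_pos diff_gt_0_iff_gt)
    have "integral (ball 0 q) (\<lambda>y::'a. (norm y)\<^sup>2 - q\<^sup>2) \<le> integral (ball 0 1) (\<lambda>y::'a. (norm y)\<^sup>2 - q\<^sup>2)"
      using q by (intro integral_ball_mono_radius) (auto intro!: continuous_intros power_mono)
    then have "q ^ (n + 2) * I - q\<^sup>2 * (q ^ n * V) \<le> I - q\<^sup>2 * V"
      using q by (simp add: diff)
    then have "q\<^sup>2 * V * (1 - q ^ n) \<le> I * (1 - q ^ (n + 2))"
      by (simp add: algebra_simps)
    then have "(1 - q) * (q\<^sup>2 * V * (\<Sum>k<n. q ^ k)) \<le> (1 - q) * (I * (\<Sum>k<n+2. q ^ k))"
      unfolding geo by (simp only: mult_ac)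
    with q show "q\<^sup>2 * V * (\<Sum>k<n. q ^ k) \<le> I * (\<Sum>k<n+2. q ^ k)"
      by (simp only: mult_le_cancel_left_pos diff_gt_0_iff_gt)
  qed
  have ev: "\<forall>\<^sub>F q in at_left 1. 0 < q \<and> q < (1::real)"
    by (rule eventually_at_leftI[of 0]) auto
  have lim: "((\<lambda>q. c q * (\<Sum>k<m. q ^ k)) \<longlongrightarrow> c 1 * real m) (at_left 1)"
    if "isCont c 1" for c :: "real \<Rightarrow> real" and m
  proof -
    have "isCont (\<lambda>q. c q * (\<Sum>k<m. q ^ k)) 1"
      using that by (intro continuous_intros) auto
    then have "((\<lambda>q. c q * (\<Sum>k<m. q ^ k)) \<longlongrightarrow> c 1 * (\<Sum>k<m. 1 ^ k)) (at 1)"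
      by (simp add: isCont_def)
    then show ?thesis by (auto intro: tendsto_mono[OF at_le])
  qed
  have "I * real (n + 2) \<le> V * real n"
    by (rule tendsto_le[OF _ lim[of "\<lambda>_. V"] lim[of "\<lambda>_. I"]])
       (auto intro!: eventually_mono[OF ev] bounds simp del: sum.lessThan_Suc add_2_eq_Suc')
  moreover have "1\<^sup>2 * V * real n \<le> I * real (n + 2)"
    by (rule tendsto_le[OF _ lim[of "\<lambda>_. I"] lim[of "\<lambda>q. q\<^sup>2 * V"]])
       (auto intro!: eventually_mono[OF ev] bounds continuous_intros simp del: sum.lessThan_Suc add_2_eq_Suc')
  ultimately have "I * real (n + 2) = V * real n" by simp
  then show ?thesis
    unfolding I_def[symmetric] V_def[symmetric] n_def[symmetric] by (simp add: field_simps)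
qed

lemma measure_lebesgue_ball_scale:
  assumes "r > 0"
  shows "measure lebesgue (ball (0::'a::euclidean_space) r) = r ^ DIM('a) * measure lebesgue (ball (0::'a) 1)"
  using content_ball_conv_unit_ball[of r "0::'a"] assms by simp

text \<open>By symmetry all coordinates contribute equally to the integral of
  \<open>(norm y)\<^sup>2\<close>, so each one carries the fraction \<open>1 / CARD('n)\<close> of
  it. This is where the denominator \<open>n + 2\<close> comes from.\<close>

lemma integral_ball_coordinate_square:
  assumes r: "r > 0"
  shows "integral (ball 0 r) (\<lambda>y::real^'n. (y $ i)\<^sup>2) =
    r\<^sup>2 / (real CARD('n) + 2) * measure lebesgue (ball (0::real^'n) r)"
proof -
  have "real CARD('n) * integral (ball 0 r) (\<lambda>y::real^'n. (y $ i)\<^sup>2) =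
      (\<Sum>j\<in>UNIV. integral (ball 0 r) (\<lambda>y::real^'n. (y $ j)\<^sup>2))"
    by (subst sum.cong[OF refl integral_ball_coordinate_square_eq[of r _ i]]) auto
  also have "\<dots> = integral (ball 0 r) (\<lambda>y::real^'n. \<Sum>j\<in>UNIV. (y $ j)\<^sup>2)"
    by (subst integral_sum) (auto intro!: integrable_on_ball_continuous continuous_intros)
  also have "\<dots> = integral (ball 0 r) (\<lambda>y::real^'n. (norm y)\<^sup>2)"
    by (simp add: norm_vec_def L2_set_def sum_nonneg)
  also have "\<dots> = r ^ CARD('n) * integral (ball 0 1) (\<lambda>y::real^'n. (norm (r *\<^sub>R y))\<^sup>2)"
    using integral_ball_scale[of "\<lambda>y::real^'n. (norm y)\<^sup>2" r] r by (simp add: continuous_intros)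
  also have "\<dots> = r\<^sup>2 * (real CARD('n) / (real CARD('n) + 2)) * measure lebesgue (ball (0::real^'n) r)"
    using r integral_unit_ball_norm_square[where 'a="real^'n"] measure_lebesgue_ball_scale[OF r, where 'a="real^'n"]
    by (simp add: power_mult_distrib)
  finally have "real CARD('n) * integral (ball 0 r) (\<lambda>y::real^'n. (y $ i)\<^sup>2) =
      real CARD('n) * (r\<^sup>2 / (real CARD('n) + 2) * measure lebesgue (ball (0::real^'n) r))"
    by simp
  then show ?thesis by (simp only: mult_cancel_left of_nat_eq_0_iff zero_less_card_finite[THEN less_not_refl2] simp_thms)
qed

text \<open>The linear part and the off-diagonal entries are odd under some reflection; what
  survives of \<open>S\<close> is its diagonal, that is, the trace.\<close>

lemma integral_ball_quadratic:
  fixes b :: "real^'n" and S :: "real^'n^'n"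
  assumes r: "r > 0"
  shows "integral (ball 0 r) (\<lambda>y. k + b \<bullet> y + y \<bullet> (S *v y)) =
    measure lebesgue (ball (0::real^'n) r) * (k + r\<^sup>2 / (real CARD('n) + 2) * trace S)"
proof -
  note int = integrable_on_ball_continuous[where 'a="real^'n"]
  define V where "V = measure lebesgue (ball (0::real^'n) r)"
  define c where "c = r\<^sup>2 / (real CARD('n) + 2)"
  have "integral (ball 0 r) (\<lambda>y::real^'n. k) = k * integral (ball 0 r) (\<lambda>y::real^'n. 1)"
    by (simp flip: integral_mult_right)
  also have "\<dots> = V * k"
    using lmeasure_integral[of "ball (0::real^'n) r"] by (simp add: V_def)
  finally have 1: "integral (ball 0 r) (\<lambda>y::real^'n. k) = V * k" .
  have "integral (ball 0 r) (\<lambda>y. b \<bullet> y) = (\<Sum>i\<in>UNIV. integral (ball 0 r) (\<lambda>y. b $ i * y $ i))"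
    unfolding inner_vec_def by (subst integral_sum) (auto intro!: int continuous_intros)
  then have 2: "integral (ball 0 r) (\<lambda>y. b \<bullet> y) = 0"
    by (simp add: integral_ball_coordinate)
  have m: "integral (ball 0 r) (\<lambda>y::real^'n. y $ i * y $ j) = (if i = j then c * V else 0)" for i j
    using integral_ball_mixed_coordinates[of i j r] integral_ball_coordinate_square[OF r, of i]
    by (auto simp: power2_eq_square c_def V_def)
  have "y \<bullet> (S *v y) = (\<Sum>i\<in>UNIV. \<Sum>j\<in>UNIV. S $ i $ j * (y $ i * y $ j))" for y
    by (simp add: inner_vec_def matrix_vector_mult_def sum_distrib_left mult_ac)
  then have "integral (ball 0 r) (\<lambda>y. y \<bullet> (S *v y)) =
      (\<Sum>i\<in>UNIV. \<Sum>j\<in>UNIV. integral (ball 0 r) (\<lambda>y. S $ i $ j * (y $ i * y $ j)))"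
    by (simp add: integral_sum int continuous_intros)
  also have "\<dots> = (\<Sum>i\<in>UNIV. \<Sum>j\<in>UNIV. S $ i $ j * (if i = j then c * V else 0))"
    by (simp add: m)
  also have "\<dots> = V * (c * trace S)"
    by (simp add: trace_def if_distrib sum_distrib_left sum_distrib_right mult_ac cong: if_cong)
  finally have 3: "integral (ball 0 r) (\<lambda>y. y \<bullet> (S *v y)) = V * (c * trace S)" .
  have "integral (ball 0 r) (\<lambda>y. k + b \<bullet> y + y \<bullet> (S *v y)) =
      integral (ball 0 r) (\<lambda>y::real^'n. k) + integral (ball 0 r) (\<lambda>y. b \<bullet> y)
      + integral (ball 0 r) (\<lambda>y. y \<bullet> (S *v y))"
    by (simp add: integral_add int continuous_intros)
  then show ?thesis
    unfolding 1 2 3 by (simp add: V_def c_def algebra_simps)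
qed

lemma
  fixes b :: "real^'n" and S :: "real^'n^'n"
  assumes g: "continuous_on UNIV g" and r: "r > 0"
  shows ball_average_ge_quadratic: "(\<And>y. norm y < r \<Longrightarrow> k + b \<bullet> y + y \<bullet> (S *v y) \<le> g y) \<Longrightarrow>
      k + r\<^sup>2 / (real CARD('n) + 2) * trace S \<le>
      1 / measure lebesgue (ball (0::real^'n) r) * integral (ball 0 r) g"
    and ball_average_le_quadratic: "(\<And>y. norm y < r \<Longrightarrow> g y \<le> k + b \<bullet> y + y \<bullet> (S *v y)) \<Longrightarrow>
      1 / measure lebesgue (ball (0::real^'n) r) * integral (ball 0 r) g \<le>
      k + r\<^sup>2 / (real CARD('n) + 2) * trace S"
proof -
  have V: "measure lebesgue (ball (0::real^'n) r) > 0"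
    using content_ball_pos[OF r] by simp
  have c: "continuous_on UNIV (\<lambda>y. k + b \<bullet> y + y \<bullet> (S *v y))"
    by (intro continuous_intros)
  note int = integrable_on_ball_continuous[OF g, of r] integrable_on_ball_continuous[OF c, of r]
  {
    assume "\<And>y. norm y < r \<Longrightarrow> k + b \<bullet> y + y \<bullet> (S *v y) \<le> g y"
    then have "integral (ball 0 r) (\<lambda>y. k + b \<bullet> y + y \<bullet> (S *v y)) \<le> integral (ball 0 r) g"
      by (intro integral_le int) auto
    with V show "k + r\<^sup>2 / (real CARD('n) + 2) * trace S \<le>
      1 / measure lebesgue (ball (0::real^'n) r) * integral (ball 0 r) g"
      unfolding integral_ball_quadratic[OF r] by (simp add: pos_le_divide_eq mult.commute)
  next
    assume "\<And>y. norm y < r \<Longrightarrow> g y \<le> k + b \<bullet> y + y \<bullet> (S *v y)"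
    then have "integral (ball 0 r) g \<le> integral (ball 0 r) (\<lambda>y. k + b \<bullet> y + y \<bullet> (S *v y))"
      by (intro integral_le int) auto
    with V show "1 / measure lebesgue (ball (0::real^'n) r) * integral (ball 0 r) g \<le>
      k + r\<^sup>2 / (real CARD('n) + 2) * trace S"
      unfolding integral_ball_quadratic[OF r] by (simp add: pos_divide_le_eq mult.commute)
  }
qed

section \<open>Symmetric matrices\<close>

definition diag_mat :: "('n \<Rightarrow> real) \<Rightarrow> real^'n^'n" where
  "diag_mat d = (\<chi> i j. if i = j then d i else 0)"

lemma diag_mat_mult_vec: "diag_mat d *v v = (\<chi> i. d i * v $ i)"
  by (simp add: diag_mat_def matrix_vector_mult_def vec_eq_iff if_distrib [where f = "\<lambda>z. z * _"] cong: if_cong)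

lemma diag_mat_mult: "diag_mat c ** diag_mat d = diag_mat (\<lambda>i. c i * d i)"
  by (simp add: matrix_eq flip: matrix_vector_mul_assoc) (simp add: diag_mat_mult_vec mult.assoc)

lemma transpose_diag_mat [simp]: "transpose (diag_mat d) = diag_mat d"
  by (auto simp: transpose_def diag_mat_def vec_eq_iff)

lemma trace_diag_mat: "trace (diag_mat d) = (\<Sum>i\<in>UNIV. d i)"
  by (simp add: trace_def diag_mat_def)

lemma det_diag_mat: "det (diag_mat d) = (\<Prod>i\<in>UNIV. d i)"
  by (subst det_diagonal) (auto simp: diag_mat_def)

section \<open>Spectral theorem for real symmetric matrices\<close>

lemma symmetric_inner:
  fixes S :: "real^'n^'n"
  assumes "transpose S = S"
  shows "v \<bullet> (S *v w) = (S *v v) \<bullet> w"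
  using assms by (metis dot_lmul_matrix transpose_matrix_vector)

text \<open>By compactness the quadratic form attains its maximum on the unit sphere of
  \<open>W\<close>. The residual \<open>S *v v - \<nu> *\<^sub>R v\<close> at a maximiser lies in
  \<open>W\<close> by invariance, hence is an admissible direction of variation, and this forces it
  to vanish.\<close>

lemma eigenvector_in_invariant_subspace:
  fixes S :: "real^'n^'n"
  assumes sym: "transpose S = S" and W: "subspace W" and inv: "\<And>w. w \<in> W \<Longrightarrow> S *v w \<in> W"
    and "W \<noteq> {0}"
  obtains v \<nu> where "v \<in> W" "norm v = 1" "S *v v = \<nu> *\<^sub>R v"
proof -
  let ?K = "W \<inter> sphere 0 1"
  obtain w where w: "w \<in> W" "w \<noteq> 0"
    using \<open>W \<noteq> {0}\<close> subspace_0[OF W] by auto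
  have "(1 / norm w) *\<^sub>R w \<in> ?K"
    using w subspace_scale[OF W] by auto
  moreover have "compact ?K"
    using closed_subspace[OF W] compact_sphere by (rule closed_Int_compact)
  moreover have "continuous_on ?K (\<lambda>v. v \<bullet> (S *v v))"
    by (intro continuous_intros)
  ultimately obtain v where v: "v \<in> ?K" and max: "\<And>z. z \<in> ?K \<Longrightarrow> z \<bullet> (S *v z) \<le> v \<bullet> (S *v v)"
    using continuous_attains_sup[of ?K "\<lambda>v. v \<bullet> (S *v v)"] by (metis empty_iff)
  define \<nu> where "\<nu> = v \<bullet> (S *v v)"
  have vW: "v \<in> W" and nv: "norm v = 1" using v by auto
  have le: "z \<bullet> (S *v z) \<le> \<nu> * (z \<bullet> z)" if z: "z \<in> W" for z
  proof (cases "z = 0")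
    case False
    have "(1 / norm z) *\<^sub>R z \<in> ?K"
      using False z subspace_scale[OF W] by auto
    from max[OF this] have "(z \<bullet> (S *v z)) / (norm z)\<^sup>2 \<le> \<nu>"
      by (simp add: \<nu>_def matrix_vector_mult_scaleR power2_eq_square)
    then show ?thesis
      using False by (simp add: pos_divide_le_eq dot_square_norm)
  qed simp
  define u where "u = S *v v - \<nu> *\<^sub>R v"
  have uW: "u \<in> W"
    unfolding u_def using vW by (intro subspace_diff subspace_scale W inv)
  \<comment> \<open>First variation of the Rayleigh quotient at its maximiser \<open>v\<close> in the direction \<open>u\<close>.\<close>
  have key: "2 * e * (u \<bullet> u) \<le> e\<^sup>2 * (\<nu> * (u \<bullet> u) - u \<bullet> (S *v u))" for e
  proof -
    have "v + e *\<^sub>R u \<in> W"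
      using vW uW by (intro subspace_add subspace_scale W)
    from le[OF this] have "v \<bullet> (S *v v) + 2 * e * (u \<bullet> (S *v v)) + e\<^sup>2 * (u \<bullet> (S *v u))
        \<le> \<nu> * (v \<bullet> v + 2 * e * (u \<bullet> v) + e\<^sup>2 * (u \<bullet> u))"
      using symmetric_inner[OF sym, of v u]
      by (simp add: matrix_vector_right_distrib matrix_vector_mult_scaleR inner_add_left inner_add_right
          inner_commute power2_eq_square algebra_simps)
    moreover have "v \<bullet> v = 1" using nv by (simp add: dot_square_norm)
    moreover have "u \<bullet> (S *v v) = u \<bullet> u + \<nu> * (u \<bullet> v)"
      by (simp add: u_def inner_diff_right inner_diff_left)
    ultimately show ?thesis
      by (simp add: \<nu>_def[symmetric] algebra_simps)
  qed
  have "u \<bullet> u = 0"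
  proof (rule ccontr)
    assume "u \<bullet> u \<noteq> 0"
    then have pos: "u \<bullet> u > 0" by simp
    \<comment> \<open>\<open>C\<close> dominates the coefficient of \<open>e\<^sup>2\<close> in
      \<open>key\<close>, and the added 1 keeps it positive. With
      \<open>e = (u \<bullet> u) / C\<close> the right side of \<open>key\<close> is at most
      \<open>e * (u \<bullet> u)\<close>, half of the left side.\<close>
    define C where "C = \<bar>\<nu> * (u \<bullet> u) - u \<bullet> (S *v u)\<bar> + 1"
    define e where "e = (u \<bullet> u) / C"
    have C: "C > 0" by (simp add: C_def)
    then have e: "e > 0" using pos by (simp add: e_def)
    have "2 * e * (u \<bullet> u) \<le> e\<^sup>2 * C"
      using key[of e] by (rule order_trans) (auto intro!: mult_left_mono simp: C_def)
    also have "\<dots> = e * (u \<bullet> u)"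
      using C by (simp add: e_def power2_eq_square)
    finally show False using e pos by simp
  qed
  then have "S *v v = \<nu> *\<^sub>R v" by (simp add: u_def)
  with vW nv show thesis by (rule that)
qed

text \<open>Symmetry makes the orthogonal complement of a set of eigenvectors invariant, and by
  dimension it is nontrivial as long as there are fewer than \<open>CARD('n)\<close> of them; the
  next eigenvector is found there. Inducting on the number of vectors avoids changing the ambient
  space.\<close>

lemma orthonormal_eigenvectors:
  fixes S :: "real^'n^'n"
  assumes sym: "transpose S = S" and "k \<le> CARD('n)"
  shows "\<exists>E. finite E \<and> card E = k \<and> pairwise orthogonal E \<and>
    (\<forall>v\<in>E. norm v = 1 \<and> (\<exists>\<nu>. S *v v = \<nu> *\<^sub>R v))"
  using assms(2)
proof (induction k)
  case 0
  then show ?case by (intro exI[of _ "{}"]) auto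
next
  case (Suc k)
  then obtain E where E: "finite E" "card E = k" "pairwise orthogonal E"
    and eig: "\<And>v. v \<in> E \<Longrightarrow> norm v = 1 \<and> (\<exists>\<nu>. S *v v = \<nu> *\<^sub>R v)"
    by auto
  let ?W = "{w. \<forall>v\<in>E. orthogonal v w}"
  have W: "subspace ?W" by (rule subspace_orthogonal_to_vectors)
  have inv: "S *v w \<in> ?W" if w: "w \<in> ?W" for w
  proof clarify
    fix v assume v: "v \<in> E"
    then obtain \<nu> where "S *v v = \<nu> *\<^sub>R v" using eig by blast
    then have "v \<bullet> (S *v w) = \<nu> * (v \<bullet> w)"
      by (simp add: symmetric_inner[OF sym])
    then show "orthogonal v (S *v w)"
      using v w by (simp add: orthogonal_def)
  qed
  have "dim E < DIM(real^'n)"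
    using dim_le_card'[OF E(1)] E(2) Suc.prems by simp
  then have "span E \<noteq> UNIV" by (metis dim_UNIV dim_span less_irrefl)
  then obtain a where a: "a \<noteq> 0" "\<And>w. w \<in> span E \<Longrightarrow> orthogonal a w"
    by (metis orthogonal_to_subspace_exists_gen[of E UNIV] psubsetI top_greatest span_UNIV)
  then have "a \<in> ?W" by (auto simp: orthogonal_commute span_base)
  with a have "?W \<noteq> {0}" by blast
  then obtain v \<nu> where v: "v \<in> ?W" "norm v = 1" "S *v v = \<nu> *\<^sub>R v"
    using eigenvector_in_invariant_subspace[OF sym W inv] by blast
  have "v \<notin> E"
    using v by (auto simp: orthogonal_def)
  moreover have "pairwise orthogonal (insert v E)"
    using v E(3) by (auto simp: pairwise_insert orthogonal_commute)
  ultimately show ?case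
    using E eig v by (intro exI[of _ "insert v E"]) auto
qed

theorem symmetric_matrix_diagonalization:
  fixes S :: "real^'n^'n"
  assumes sym: "transpose S = S"
  obtains Q d where "orthogonal_matrix Q" "S = Q ** diag_mat d ** transpose Q"
proof -
  obtain E where E: "finite E" "card E = CARD('n)" "pairwise orthogonal E"
    and eig: "\<And>v. v \<in> E \<Longrightarrow> norm v = 1 \<and> (\<exists>\<nu>. S *v v = \<nu> *\<^sub>R v)"
    using orthonormal_eigenvectors[OF sym order_refl] by auto
  obtain e where e: "bij_betw e (UNIV :: 'n set) E"
    using finite_same_card_bij[of "UNIV :: 'n set" E] E by auto
  then have eE: "e i \<in> E" for i by (auto simp: bij_betw_def)
  obtain d where d: "S *v e i = d i *\<^sub>R e i" for i
    using eig[OF eE] by metis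
  \<comment> \<open>With the eigenvectors as columns, \<open>S ** Q = Q ** diag_mat d\<close> is the
    eigenvalue equation read column by column.\<close>
  define Q :: "real^'n^'n" where "Q = (\<chi> i j. e j $ i)"
  have col: "column j Q = e j" for j
    by (simp add: Q_def column_def vec_eq_iff)
  have Q: "orthogonal_matrix Q"
    unfolding orthogonal_matrix_orthonormal_columns col
    using eig[OF eE] E(3) eE e by (auto simp: pairwise_def bij_betw_def inj_on_def) (metis)
  have "S ** Q = Q ** diag_mat d"
  proof -
    have "(S ** Q) $ i $ j = (Q ** diag_mat d) $ i $ j" for i j
    proof -
      have "(S ** Q) $ i $ j = (S *v e j) $ i"
        by (simp add: matrix_matrix_mult_def matrix_vector_mult_def Q_def)
      also have "\<dots> = (Q ** diag_mat d) $ i $ j"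
        by (simp add: d matrix_matrix_mult_def Q_def diag_mat_def if_distrib cong: if_cong)
      finally show ?thesis .
    qed
    then show ?thesis by (simp add: vec_eq_iff)
  qed
  then have "S = Q ** diag_mat d ** transpose Q"
    using Q by (metis matrix_mul_assoc matrix_mul_rid orthogonal_matrix_def)
  with Q show thesis by (rule that)
qed

lemma trace_orthogonal_conjugate:
  fixes Q D :: "real^'n^'n"
  assumes "orthogonal_matrix Q"
  shows "trace (Q ** D ** transpose Q) = trace D"
  using assms trace_mul_sym[of "Q ** D" "transpose Q"]
  by (simp add: matrix_mul_assoc orthogonal_matrix_def)

lemma det_orthogonal_conjugate:
  fixes Q D :: "real^'n^'n"
  assumes "orthogonal_matrix Q"
  shows "det (Q ** D ** transpose Q) = det D"
proof -
  have "det Q * det (transpose Q) = 1"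
    using assms by (metis det_I det_mul orthogonal_matrix_def)
  then show ?thesis by (simp add: det_mul)
qed

lemma inner_orthogonal_conjugate_diag:
  fixes Q :: "real^'n^'n"
  shows "v \<bullet> ((Q ** diag_mat d ** transpose Q) *v v) = (\<Sum>i\<in>UNIV. d i * ((transpose Q *v v) $ i)\<^sup>2)"
proof -
  have "v \<bullet> ((Q ** diag_mat d ** transpose Q) *v v) = (transpose Q *v v) \<bullet> (diag_mat d *v (transpose Q *v v))"
    by (simp add: dot_lmul_matrix flip: matrix_vector_mul_assoc)
  then show ?thesis
    by (simp add: diag_mat_mult_vec inner_vec_def power2_eq_square mult_ac)
qed

lemma norm_transpose_orthogonal:
  fixes Q :: "real^'n^'n"
  assumes "orthogonal_matrix Q"
  shows "norm (transpose Q *v v) = norm v"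
  using assms orthogonal_transformation_matrix[of "(*v) (transpose Q)"]
  by (simp add: orthogonal_transformation orthogonal_matrix_transpose)

section \<open>Trace and determinant of positive semidefinite matrices\<close>

definition psd :: "real^'n^'n \<Rightarrow> bool" where
  "psd S \<longleftrightarrow> transpose S = S \<and> (\<forall>v. 0 \<le> v \<bullet> (S *v v))"

lemma psd_diagonalization:
  fixes S :: "real^'n^'n"
  assumes "psd S"
  obtains Q d where "orthogonal_matrix Q" "S = Q ** diag_mat d ** transpose Q" "\<And>i. 0 \<le> d i"
proof -
  obtain Q d where Q: "orthogonal_matrix Q" and S: "S = Q ** diag_mat d ** transpose Q"
    using assms symmetric_matrix_diagonalization[of S] by (auto simp: psd_def)
  have "0 \<le> d i" for i
  proof -
    \<comment> \<open>Testing the form on the eigenvector \<open>Q *v axis i 1\<close> isolates the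
      single eigenvalue \<open>d i\<close>.\<close>
    have *: "transpose Q *v (Q *v axis i 1) = axis i 1"
      using Q by (simp add: orthogonal_matrix_def matrix_vector_mul_assoc)
    have "0 \<le> (Q *v axis i 1) \<bullet> (S *v (Q *v axis i 1))"
      using assms by (simp add: psd_def)
    also have "\<dots> = (\<Sum>j\<in>UNIV. d j * ((axis i 1 :: real^'n) $ j)\<^sup>2)"
      unfolding S inner_orthogonal_conjugate_diag * ..
    also have "\<dots> = d i"
      by (simp add: axis_def if_distrib[where f = "\<lambda>z. d _ * z\<^sup>2"] cong: if_cong)
    finally show ?thesis .
  qed
  with Q S show thesis by (rule that)
qed

lemma root_det_le_trace:
  fixes S :: "real^'n^'n"
  assumes "psd S"
  shows "real CARD('n) * root CARD('n) (det S) \<le> trace S"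
proof -
  obtain Q d where Q: "orthogonal_matrix Q" and S: "S = Q ** diag_mat d ** transpose Q"
    and d: "\<And>i. 0 \<le> d i"
    using psd_diagonalization[OF assms] by blast
  have "(\<Prod>i\<in>UNIV. d i) powr (1 / CARD('n)) \<le> (\<Sum>i\<in>UNIV. d i / CARD('n))"
    using d by (intro arith_geom_mean) auto
  moreover have "root CARD('n) (\<Prod>i\<in>UNIV. d i) = (\<Prod>i\<in>UNIV. d i) powr (1 / CARD('n))"
    using d by (intro root_powr_inverse) (auto intro: prod_nonneg)
  ultimately show ?thesis
    unfolding S det_orthogonal_conjugate[OF Q] trace_orthogonal_conjugate[OF Q] det_diag_mat trace_diag_mat
    by (simp add: field_simps flip: sum_divide_distrib)
qed

lemma psd_det_nonneg: "psd S \<Longrightarrow> 0 \<le> det S"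
  by (erule psd_diagonalization) (auto simp: det_orthogonal_conjugate det_diag_mat intro: prod_nonneg)

text \<open>The constant is the smallest eigenvalue, positive because the determinant is their
  product. It later allows a small multiple of the squared norm to be absorbed into the Hessian
  form.\<close>

lemma psd_coercive:
  fixes S :: "real^'n^'n"
  assumes "psd S" "det S \<noteq> 0"
  obtains m where "m > 0" "\<And>v. m * (v \<bullet> v) \<le> v \<bullet> (S *v v)"
proof -
  obtain Q d where Q: "orthogonal_matrix Q" and S: "S = Q ** diag_mat d ** transpose Q"
    and d: "\<And>i. 0 \<le> d i"
    using psd_diagonalization[OF assms(1)] by blast
  have "d i \<noteq> 0" for i
    using assms(2) by (auto simp: S det_orthogonal_conjugate[OF Q] det_diag_mat)
  with d have pos: "d i > 0" for i by (simp add: order_less_le)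
  define m where "m = Min (range d)"
  have "m > 0" using pos by (simp add: m_def)
  moreover have "m * (v \<bullet> v) \<le> v \<bullet> (S *v v)" for v
  proof -
    have "m * (v \<bullet> v) = m * ((transpose Q *v v) \<bullet> (transpose Q *v v))"
      using norm_transpose_orthogonal[OF Q, of v] by (simp add: dot_square_norm)
    also have "\<dots> = (\<Sum>i\<in>UNIV. m * ((transpose Q *v v) $ i)\<^sup>2)"
      by (simp add: inner_vec_def power2_eq_square sum_distrib_left)
    also have "\<dots> \<le> (\<Sum>i\<in>UNIV. d i * ((transpose Q *v v) $ i)\<^sup>2)"
      by (intro sum_mono mult_right_mono) (auto simp: m_def)
    finally show ?thesis by (simp add: S inner_orthogonal_conjugate_diag)
  qed
  ultimately show thesis by (rule that)
qed

text \<open>Along the points \<open>A *v y\<close> the Hessian acts on \<open>y\<close> as the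
  congruent matrix, and it is the trace of that matrix which the average over the ball
  produces.\<close>

lemma inner_congruence:
  fixes H A :: "real^'n^'n"
  shows "v \<bullet> ((transpose A ** H ** A) *v v) = (A *v v) \<bullet> (H *v (A *v v))"
proof -
  have "v \<bullet> ((transpose A ** H ** A) *v v) = ((H *v (A *v v)) v* A) \<bullet> v"
    by (simp add: inner_commute flip: matrix_vector_mul_assoc)
  also have "\<dots> = (A *v v) \<bullet> (H *v (A *v v))"
    by (subst dot_lmul_matrix) (rule inner_commute)
  finally show ?thesis .
qed

lemma psd_congruence:
  fixes H A :: "real^'n^'n"
  assumes "psd H"
  shows "psd (transpose A ** H ** A)"
  using assms unfolding psd_def inner_congruence
  by (simp add: matrix_transpose_mul matrix_mul_assoc)

lemma trace_congruence_ge_root_det: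
  fixes H A :: "real^'n^'n"
  assumes "psd H" "det A = 1"
  shows "real CARD('n) * root CARD('n) (det H) \<le> trace (transpose A ** H ** A)"
  using root_det_le_trace[OF psd_congruence[OF assms(1), of A]] assms(2) by (simp add: det_mul)

text \<open>Equality in the arithmetic-geometric mean inequality requires all eigenvalues of the
  congruent matrix to coincide, so \<open>A\<close> should share the eigenvectors of
  \<open>H\<close> and have eigenvalues proportional to \<open>1 / sqrt (d i)\<close>. As some
  \<open>d i\<close> may vanish, each is first raised by a small \<open>\<kappa>\<close>; the slack
  \<open>\<delta>\<close> pays for this.\<close>

lemma trace_congruence_near_root_det:
  fixes H :: "real^'n^'n"
  assumes "psd H" "\<delta> > 0"
  obtains A where "spd A" "det A = 1"
    "trace (transpose A ** H ** A) \<le> real CARD('n) * (root CARD('n) (det H) + \<delta>)"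
proof -
  obtain Q d where Q: "orthogonal_matrix Q" and H: "H = Q ** diag_mat d ** transpose Q"
    and d: "\<And>i. 0 \<le> d i"
    using psd_diagonalization[OF assms(1)] by blast
  let ?n = "CARD('n)"
  \<comment> \<open>\<open>g 0\<close> is the root of \<open>det H\<close>. The root is continuous
    also at 0, so some positive \<open>\<kappa>\<close> changes it by less than
    \<open>\<delta>\<close>.\<close>
  define g where "g \<kappa> = root ?n (\<Prod>i\<in>UNIV. d i + \<kappa>)" for \<kappa>
  have "(g \<longlongrightarrow> g 0) (at_right 0)"
    unfolding g_def by (intro tendsto_intros)
  then have "\<forall>\<^sub>F \<kappa> in at_right 0. g \<kappa> < g 0 + \<delta>"
    using assms(2) by (intro order_tendstoD) auto
  then have "\<forall>\<^sub>F \<kappa> in at_right 0. g \<kappa> < g 0 + \<delta> \<and> \<kappa> > 0"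
    using eventually_at_right_less by eventually_elim auto
  then obtain \<kappa> where \<kappa>: "g \<kappa> < g 0 + \<delta>" "\<kappa> > 0"
    using eventually_happens'[OF trivial_limit_at_right_real] by blast
  define \<mu> where "\<mu> i = d i + \<kappa>" for i
  have \<mu>: "\<mu> i > 0" for i using d[of i] \<kappa> by (simp add: \<mu>_def)
  have gpos: "g \<kappa> > 0"
    unfolding g_def \<mu>_def[symmetric] using \<mu> by (simp add: prod_pos)
  \<comment> \<open>Chosen so that \<open>(a i)\<^sup>2 * \<mu> i\<close> is the same number for all
    \<open>i\<close>. The value \<open>g \<kappa>\<close>, the geometric mean of the
    \<open>\<mu> i\<close>, is what makes the determinant 1.\<close>
  define a where "a i = sqrt (g \<kappa> / \<mu> i)" for i
  have a: "a i > 0" for i using \<mu>[of i] gpos by (simp add: a_def)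
  define A where "A = Q ** diag_mat a ** transpose Q"
  have trA: "transpose A = A"
    by (simp add: A_def matrix_transpose_mul matrix_mul_assoc)
  have "spd A"
    unfolding spd_def
  proof (intro conjI allI impI trA)
    fix v :: "real^'n" assume "v \<noteq> 0"
    then have "transpose Q *v v \<noteq> 0"
      using norm_transpose_orthogonal[OF Q, of v] by auto
    then obtain j where j: "(transpose Q *v v) $ j \<noteq> 0"
      by (auto simp: vec_eq_iff)
    have "0 < (\<Sum>i\<in>UNIV. a i * ((transpose Q *v v) $ i)\<^sup>2)"
    proof (rule sum_pos2[of _ j])
      show "0 < a j * ((transpose Q *v v) $ j)\<^sup>2"
        by (intro mult_pos_pos a) (use j in simp)
      show "0 \<le> a i * ((transpose Q *v v) $ i)\<^sup>2" for i
        by (intro mult_nonneg_nonneg less_imp_le[OF a]) simp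
    qed simp_all
    then show "0 < v \<bullet> (A *v v)"
      by (simp add: A_def inner_orthogonal_conjugate_diag)
  qed
  moreover have "det A = 1"
  proof -
    have detA: "det A = (\<Prod>i\<in>UNIV. a i)"
      by (simp add: A_def det_orthogonal_conjugate[OF Q] det_diag_mat)
    have "(a i)\<^sup>2 = g \<kappa> / \<mu> i" for i
      using gpos \<mu>[of i] by (simp add: a_def)
    \<comment> \<open>Squaring removes the square roots in \<open>a\<close>; positivity of the
      determinant then selects the root 1.\<close>
    then have "(det A)\<^sup>2 = (\<Prod>i\<in>UNIV. g \<kappa> / \<mu> i)"
      unfolding detA by (simp add: prod_power_distrib)
    also have "(\<Prod>i\<in>UNIV. g \<kappa> / \<mu> i) = g \<kappa> ^ ?n / (\<Prod>i\<in>UNIV. \<mu> i)"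
      by (simp add: prod_dividef)
    also have "g \<kappa> ^ ?n = (\<Prod>i\<in>UNIV. \<mu> i)"
      unfolding g_def \<mu>_def[symmetric] using \<mu> by (intro real_root_pow_pos2 prod_nonneg) (simp_all add: less_imp_le)
    also have "(\<Prod>i\<in>UNIV. \<mu> i) / (\<Prod>i\<in>UNIV. \<mu> i) = 1"
      using prod_pos[of UNIV \<mu>] \<mu> by (metis UNIV_I divide_self less_irrefl)
    finally have "(det A)\<^sup>2 = 1" .
    moreover have "det A > 0" unfolding detA by (intro prod_pos a)
    ultimately show ?thesis by (simp add: power2_eq_1_iff)
  qed
  moreover have "trace (transpose A ** H ** A) \<le> real ?n * (root ?n (det H) + \<delta>)"
  proof -
    have QQ: "transpose Q ** Q = mat 1" using Q by (simp add: orthogonal_matrix_def)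
    have "transpose A ** H ** A = Q ** diag_mat a ** (transpose Q ** Q) ** diag_mat d ** (transpose Q ** Q) ** diag_mat a ** transpose Q"
      unfolding trA by (simp only: A_def H matrix_mul_assoc)
    also have "\<dots> = Q ** diag_mat (\<lambda>i. a i * d i * a i) ** transpose Q"
    proof -
      have "diag_mat a ** diag_mat d ** diag_mat a = diag_mat (\<lambda>i. a i * d i * a i)"
        by (simp only: diag_mat_mult)
      then show ?thesis
        unfolding QQ matrix_mul_rid by (metis matrix_mul_assoc)
    qed
    finally have "trace (transpose A ** H ** A) = (\<Sum>i\<in>UNIV. a i * d i * a i)"
      by (simp add: trace_orthogonal_conjugate[OF Q] trace_diag_mat)
    also have "\<dots> \<le> (\<Sum>i\<in>(UNIV::'n set). g \<kappa>)"
    proof (rule sum_mono)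
      fix i
      have "a i * d i * a i = (a i)\<^sup>2 * d i" by (simp add: power2_eq_square)
      also have "(a i)\<^sup>2 = g \<kappa> / \<mu> i" using gpos \<mu>[of i] by (simp add: a_def)
      also have "g \<kappa> / \<mu> i * d i = g \<kappa> * (d i / \<mu> i)" by simp
      also have "\<dots> \<le> g \<kappa> * 1"
        using gpos \<mu>[of i] \<kappa>(2) by (intro mult_left_mono) (simp_all add: \<mu>_def)
      finally show "a i * d i * a i \<le> g \<kappa>" by simp
    qed
    also have "\<dots> = real ?n * g \<kappa>" by simp
    also have "\<dots> \<le> real ?n * (g 0 + \<delta>)"
      using \<kappa> by (intro mult_left_mono) auto
    also have "g 0 = root ?n (det H)"
      by (simp add: g_def H det_orthogonal_conjugate[OF Q] det_diag_mat)
    finally show ?thesis .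
  qed
  ultimately show thesis by (rule that)
qed

text \<open>The hypothesis bounds only the quadratic form. To bound the norm, nonnegativity of the
  form is tested on \<open>v - r *\<^sub>R (A *v v)\<close>; for \<open>r = 1 / \<theta>\<close> the
  quadratic term in \<open>r\<close> cancels at most half of the linear one, and the rest is the
  claim.\<close>

lemma spd_norm_le:
  fixes A :: "real^'n^'n"
  assumes "spd A" "mat_le_scalar A \<theta>" "\<theta> > 0"
  shows "norm (A *v v) \<le> \<theta> * norm v"
proof -
  have sym: "transpose A = A"
    using assms(1) by (simp add: spd_def)
  have nonneg: "0 \<le> w \<bullet> (A *v w)" for w
    using assms(1) by (cases "w = 0") (auto simp: spd_def less_imp_le)
  define w where "w = A *v v"
  have le: "z \<bullet> (A *v z) \<le> \<theta> * (z \<bullet> z)" for z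
    using assms(2) by (simp add: mat_le_scalar_def)
  define r where "r = 1 / \<theta>"
  have r: "r > 0" "\<theta> * r = 1" using assms(3) by (simp_all add: r_def)
  have vAw: "v \<bullet> (A *v w) = w \<bullet> w"
    using symmetric_inner[OF sym, of v w] by (simp add: w_def)
  have "0 \<le> (v - r *\<^sub>R w) \<bullet> (A *v (v - r *\<^sub>R w))" by (rule nonneg)
  also have "\<dots> = v \<bullet> (A *v v) - 2 * r * (w \<bullet> w) + r\<^sup>2 * (w \<bullet> (A *v w))"
    by (simp add: vAw matrix_vector_mult_diff_distrib matrix_vector_mult_scaleR inner_diff_left
      inner_diff_right power2_eq_square w_def[symmetric] algebra_simps)
  also have "\<dots> \<le> \<theta> * (v \<bullet> v) - 2 * r * (w \<bullet> w) + r\<^sup>2 * (\<theta> * (w \<bullet> w))"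
    by (intro add_mono diff_mono mult_left_mono le order_refl zero_le_power2)
  also have "r\<^sup>2 * (\<theta> * (w \<bullet> w)) = (\<theta> * r) * (r * (w \<bullet> w))"
    by (simp only: power2_eq_square mult_ac)
  finally have "r * (w \<bullet> w) \<le> \<theta> * (v \<bullet> v)"
    by (simp add: r)
  then have "\<theta> * (r * (w \<bullet> w)) \<le> \<theta> * (\<theta> * (v \<bullet> v))"
    using assms(3) by (intro mult_left_mono) simp_all
  then have "(\<theta> * r) * (w \<bullet> w) \<le> \<theta>\<^sup>2 * (v \<bullet> v)"
    by (simp only: power2_eq_square mult.assoc)
  then have "w \<bullet> w \<le> \<theta>\<^sup>2 * (v \<bullet> v)"
    by (simp add: r)
  then have "(norm w)\<^sup>2 \<le> (\<theta> * norm v)\<^sup>2"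
    by (simp add: dot_square_norm power_mult_distrib)
  then show ?thesis
    unfolding w_def by (rule power2_le_imp_le) (use assms(3) in simp)
qed

section \<open>Convex functions and averages\<close>

lemma has_real_derivative_along_line:
  fixes g :: "'a::real_inner \<Rightarrow> real"
  assumes "(g has_derivative (\<lambda>k. D \<bullet> k)) (at (x + r *\<^sub>R h))"
  shows "((\<lambda>r. g (x + r *\<^sub>R h)) has_real_derivative (D \<bullet> h)) (at r)"
proof -
  have "((\<lambda>r. x + r *\<^sub>R h) has_derivative (\<lambda>r. r *\<^sub>R h)) (at r)"
    by (auto intro!: derivative_eq_intros)
  from has_derivative_compose[OF this assms]
  show ?thesis by (simp add: has_field_derivative_def mult_commute_abs)
qed

lemma has_vector_derivative_along_line:
  fixes G :: "'a::real_normed_vector \<Rightarrow> 'b::real_normed_vector"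
  assumes G: "(G has_derivative L) (at (x + r *\<^sub>R h))"
  shows "((\<lambda>r. G (x + r *\<^sub>R h)) has_vector_derivative L h) (at r)"
proof -
  have "((\<lambda>r. x + r *\<^sub>R h) has_derivative (\<lambda>r. r *\<^sub>R h)) (at r)"
    by (auto intro!: derivative_eq_intros)
  from has_derivative_compose[OF this G]
  show ?thesis
    using linear_scale[OF has_derivative_linear[OF G]] by (simp add: has_vector_derivative_def)
qed

text \<open>It serves twice: it makes the gradient monotone, hence the Hessian positive
  semidefinite, and it is itself the lower bound at points where the Hessian is singular.\<close>

lemma convex_above_tangent_plane:
  fixes g :: "'a::real_inner \<Rightarrow> real"
  assumes conv: "convex_on UNIV g" and deriv: "(g has_derivative (\<lambda>k. D \<bullet> k)) (at x)"
  shows "g x + D \<bullet> h \<le> g (x + h)"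
proof -
  have "convex_on UNIV (\<lambda>r. g (x + r *\<^sub>R h))"
  proof (rule convex_onI)
    fix t a b :: real assume "0 < t" "t < 1"
    then have "g ((1 - t) *\<^sub>R (x + a *\<^sub>R h) + t *\<^sub>R (x + b *\<^sub>R h))
        \<le> (1 - t) * g (x + a *\<^sub>R h) + t * g (x + b *\<^sub>R h)"
      by (intro convex_onD[OF conv]) auto
    then show "g (x + ((1 - t) *\<^sub>R a + t *\<^sub>R b) *\<^sub>R h) \<le> (1 - t) * g (x + a *\<^sub>R h) + t * g (x + b *\<^sub>R h)"
      by (simp add: algebra_simps)
  qed simp
  moreover have "((\<lambda>r. g (x + r *\<^sub>R h)) has_real_derivative (D \<bullet> h)) (at 0)"
    using deriv by (intro has_real_derivative_along_line) simp
  ultimately have "(D \<bullet> h) * (1 - 0) \<le> g (x + 1 *\<^sub>R h) - g (x + 0 *\<^sub>R h)"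
    by (intro convex_on_imp_above_tangent[of UNIV "\<lambda>r. g (x + r *\<^sub>R h)"]) auto
  then show ?thesis by simp
qed

text \<open>The mean value theorem in direction \<open>a\<close> turns the second difference into a
  difference of gradients at two points near \<open>x\<close>, to which differentiability of
  \<open>D\<close> at \<open>x\<close> applies. Continuity of second derivatives is not
  involved.\<close>

lemma second_difference_tendsto:
  fixes g :: "real^'n \<Rightarrow> real" and H :: "real^'n^'n"
  assumes g: "\<And>y. (g has_derivative (\<lambda>h. D y \<bullet> h)) (at y)"
    and D: "(D has_derivative (\<lambda>h. H *v h)) (at x)"
  shows "((\<lambda>s. (g (x + s *\<^sub>R a + s *\<^sub>R b) - g (x + s *\<^sub>R a) - g (x + s *\<^sub>R b) + g x) / s\<^sup>2)
    \<longlongrightarrow> (H *v b) \<bullet> a) (at_right 0)"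
proof (rule tendstoI)
  fix e :: real assume e: "e > 0"
  \<comment> \<open>Both points at which the gradient is expanded lie within \<open>s * M\<close> of
    \<open>x\<close>. The two expansion errors are then at most \<open>\<eta> * (s * M)\<close>
    each, and the 4 in \<open>\<eta>\<close> makes their total contribution to the quotient at most
    \<open>e / 2\<close>.\<close>
  define M where "M = norm a + norm b + 1"
  have M: "M > 0" by (simp add: M_def add_nonneg_pos)
  define \<eta> where "\<eta> = e / (4 * M * M)"
  have \<eta>: "\<eta> > 0" using e M by (simp add: \<eta>_def)
  obtain \<delta> where \<delta>: "\<delta> > 0" "\<And>k. norm k < \<delta> \<Longrightarrow> norm (D (x + k) - D x - H *v k) \<le> \<eta> * norm k"
  proof -
    from D \<eta> obtain d where d: "d > 0"
      "\<And>y. norm (y - x) < d \<Longrightarrow> norm (D y - D x - H *v (y - x)) \<le> \<eta> * norm (y - x)"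
      unfolding has_derivative_at_alt by blast
    show thesis
    proof (rule that[OF d(1)])
      fix k :: "real^'n" assume "norm k < d"
      then show "norm (D (x + k) - D x - H *v k) \<le> \<eta> * norm k"
        using d(2)[of "x + k"] by simp
    qed
  qed
  have "\<forall>\<^sub>F s in at_right 0. 0 < s \<and> s < \<delta> / M"
    using \<delta>(1) M by (intro eventually_at_rightI[of 0 "\<delta> / M"]) auto
  then show "\<forall>\<^sub>F s in at_right 0.
    dist ((g (x + s *\<^sub>R a + s *\<^sub>R b) - g (x + s *\<^sub>R a) - g (x + s *\<^sub>R b) + g x) / s\<^sup>2) ((H *v b) \<bullet> a) < e"
  proof (rule eventually_mono, elim conjE)
    fix s :: real assume s: "0 < s" "s < \<delta> / M"
    then have sM: "s * M < \<delta>" using M by (simp add: pos_less_divide_eq)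
    \<comment> \<open>\<open>p r\<close> is the increment in direction \<open>b\<close>, taken at
      distance \<open>r\<close> along \<open>a\<close>; the second difference is
      \<open>p s - p 0\<close>.\<close>
    define p where "p r = g (x + s *\<^sub>R b + r *\<^sub>R a) - g (x + r *\<^sub>R a)" for r
    define F where "F = g (x + s *\<^sub>R a + s *\<^sub>R b) - g (x + s *\<^sub>R a) - g (x + s *\<^sub>R b) + g x"
    have "DERIV p r :> D (x + s *\<^sub>R b + r *\<^sub>R a) \<bullet> a - D (x + r *\<^sub>R a) \<bullet> a" for r
      unfolding p_def by (intro DERIV_diff has_real_derivative_along_line g)
    then obtain \<xi> where \<xi>: "0 < \<xi>" "\<xi> < s"
      and eq: "p s - p 0 = (s - 0) * (D (x + s *\<^sub>R b + \<xi> *\<^sub>R a) \<bullet> a - D (x + \<xi> *\<^sub>R a) \<bullet> a)"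
      using MVT2[OF s(1), of p "\<lambda>r. D (x + s *\<^sub>R b + r *\<^sub>R a) \<bullet> a - D (x + r *\<^sub>R a) \<bullet> a"] by blast
    define k1 where "k1 = s *\<^sub>R b + \<xi> *\<^sub>R a"
    define k2 where "k2 = \<xi> *\<^sub>R a"
    have "norm k1 \<le> s * norm b + \<xi> * norm a"
      unfolding k1_def using s \<xi> by (intro norm_triangle_le) simp
    also have "\<dots> \<le> s * norm b + s * norm a"
      using \<xi> by (intro add_left_mono mult_right_mono) auto
    also have "\<dots> \<le> s * M" using s by (simp add: M_def algebra_simps)
    finally have k1: "norm k1 \<le> s * M" .
    have "norm k2 \<le> s * norm a"
      unfolding k2_def using s \<xi> by (auto intro!: mult_right_mono)
    also have "\<dots> \<le> s * M" using s by (simp add: M_def)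
    finally have k2: "norm k2 \<le> s * M" .
    define E where "E k = D (x + k) - D x - H *v k" for k
    have E: "norm (E k) \<le> \<eta> * (s * M)" if "norm k \<le> s * M" for k
    proof -
      have "norm (E k) \<le> \<eta> * norm k" unfolding E_def using that sM by (intro \<delta>) auto
      also have "\<dots> \<le> \<eta> * (s * M)" using that \<eta> by (intro mult_left_mono) auto
      finally show ?thesis .
    qed
    have "F = p s - p 0" by (simp add: F_def p_def algebra_simps)
    also have "\<dots> = s * ((D (x + k1) - D (x + k2)) \<bullet> a)"
      unfolding eq by (simp add: k1_def k2_def inner_diff_left algebra_simps)
    also have "D (x + k1) - D (x + k2) = H *v (k1 - k2) + (E k1 - E k2)"
      by (simp add: E_def matrix_vector_mult_diff_distrib)
    also have "H *v (k1 - k2) = s *\<^sub>R (H *v b)"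
      by (simp add: k1_def k2_def matrix_vector_mult_scaleR)
    finally have F: "F = s\<^sup>2 * ((H *v b) \<bullet> a) + s * ((E k1 - E k2) \<bullet> a)"
      by (simp add: inner_add_left power2_eq_square algebra_simps)
    have "\<bar>(E k1 - E k2) \<bullet> a\<bar> \<le> norm (E k1 - E k2) * norm a"
      by (rule Cauchy_Schwarz_ineq2)
    also have "\<dots> \<le> (\<eta> * (s * M) + \<eta> * (s * M)) * M"
      using E[OF k1] E[OF k2] norm_triangle_ineq4[of "E k1" "E k2"] \<eta> s M
      by (intro mult_mono) (auto simp: M_def)
    also have "\<dots> = s * (e / 2)" using M by (simp add: \<eta>_def field_simps)
    finally have "\<bar>(E k1 - E k2) \<bullet> a\<bar> / s \<le> e / 2"
      using s by (simp add: pos_divide_le_eq mult.commute)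
    moreover have "F / s\<^sup>2 - (H *v b) \<bullet> a = ((E k1 - E k2) \<bullet> a) / s"
      using s by (simp add: F field_simps power2_eq_square)
    ultimately have "dist (F / s\<^sup>2) ((H *v b) \<bullet> a) \<le> e / 2"
      using s by (simp add: dist_real_def)
    then show "dist ((g (x + s *\<^sub>R a + s *\<^sub>R b) - g (x + s *\<^sub>R a) - g (x + s *\<^sub>R b) + g x) / s\<^sup>2) ((H *v b) \<bullet> a) < e"
      using e unfolding F_def by simp
  qed
qed

text \<open>Test functions come without a symmetry condition on \<open>D2\<phi>\<close>, so symmetry
  is derived: the second difference is unchanged when \<open>a\<close> and \<open>b\<close> are
  swapped, hence so is its limit.\<close>

lemma hessian_symmetric:
  fixes g :: "real^'n \<Rightarrow> real" and H :: "real^'n^'n"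
  assumes g: "\<And>y. (g has_derivative (\<lambda>h. D y \<bullet> h)) (at y)"
    and D: "(D has_derivative (\<lambda>h. H *v h)) (at x)"
  shows "transpose H = H"
proof -
  have "(H *v b) \<bullet> a = (H *v a) \<bullet> b" for a b
  proof -
    have "((\<lambda>s. (g (x + s *\<^sub>R a + s *\<^sub>R b) - g (x + s *\<^sub>R a) - g (x + s *\<^sub>R b) + g x) / s\<^sup>2)
      \<longlongrightarrow> (H *v a) \<bullet> b) (at_right 0)"
      using second_difference_tendsto[OF g D, of b a] by (simp add: algebra_simps)
    then show ?thesis
      using tendsto_unique[OF trivial_limit_at_right_real second_difference_tendsto[OF g D, of a b]] by blast
  qed
  from this[of "axis _ 1" "axis _ 1"] have "H $ i $ j = H $ j $ i" for i j
    by (simp add: inner_axis matrix_vector_mult_basis column_def)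
  then show ?thesis by (simp add: transpose_def vec_eq_iff)
qed

text \<open>Adding the tangent inequalities at \<open>x\<close> and at \<open>x + k\<close> shows
  that the gradient is monotone. Thus the difference quotients of \<open>v \<bullet> D\<close> along
  \<open>v\<close> are nonnegative, and they converge to the Hessian form.\<close>

lemma convex_hessian_psd:
  fixes g :: "real^'n \<Rightarrow> real" and H :: "real^'n^'n"
  assumes g: "\<And>y. (g has_derivative (\<lambda>h. D y \<bullet> h)) (at y)"
    and D: "(D has_derivative (\<lambda>h. H *v h)) (at x)" and conv: "convex_on UNIV g"
  shows "psd H"
  unfolding psd_def
proof (intro conjI allI)
  show "transpose H = H" using g D by (rule hessian_symmetric)
  fix v
  have mono: "0 \<le> (D (x + k) - D x) \<bullet> k" for k
    using convex_above_tangent_plane[OF conv g, of x k]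
      convex_above_tangent_plane[OF conv g, of "x + k" "- k"]
    by (simp add: inner_diff_left)
  have "((\<lambda>r. v \<bullet> D (x + r *\<^sub>R v)) has_vector_derivative v \<bullet> (H *v v)) (at 0)"
    using D by (intro bounded_linear.has_vector_derivative[OF bounded_linear_inner_right]
        has_vector_derivative_along_line) simp
  then have "((\<lambda>r. (v \<bullet> D (x + r *\<^sub>R v) - v \<bullet> D x) / r) \<longlongrightarrow> v \<bullet> (H *v v)) (at 0)"
    by (simp add: DERIV_def flip: has_real_derivative_iff_has_vector_derivative)
  then have "((\<lambda>r. (v \<bullet> D (x + r *\<^sub>R v) - v \<bullet> D x) / r) \<longlongrightarrow> v \<bullet> (H *v v)) (at_right 0)"
    by (simp add: filterlim_at_split)
  then show "0 \<le> v \<bullet> (H *v v)"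
  proof (rule tendsto_lowerbound)
    have "0 \<le> (v \<bullet> D (x + r *\<^sub>R v) - v \<bullet> D x) / r" if "r > 0" for r
      using mono[of "r *\<^sub>R v"] that by (simp add: inner_commute inner_diff_right zero_le_mult_iff)
    then show "\<forall>\<^sub>F r in at_right 0. 0 \<le> (v \<bullet> D (x + r *\<^sub>R v) - v \<bullet> D x) / r"
      by (intro eventually_at_rightI[of 0 1]) auto
  qed simp
qed

lemma taylor_second_order:
  fixes g :: "real^'n \<Rightarrow> real" and H :: "real^'n \<Rightarrow> real^'n^'n"
  assumes g: "\<And>y. (g has_derivative (\<lambda>h. D y \<bullet> h)) (at y)"
    and D: "\<And>y. (D has_derivative (\<lambda>h. H y *v h)) (at y)"
  obtains \<xi> where "0 < \<xi>" "\<xi> < 1" 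
    "g (x + h) = g x + D x \<bullet> h + 1/2 * (h \<bullet> (H (x + \<xi> *\<^sub>R h) *v h))"
proof -
  \<comment> \<open>The family of derivatives along the segment in the shape that
    \<open>Maclaurin\<close> takes. Orders 0, 1 and 2 are the true derivatives; higher orders get a
    dummy value.\<close>
  define d where "d m r = (if m = 0 then g (x + r *\<^sub>R h) else if m = 1 then D (x + r *\<^sub>R h) \<bullet> h
    else h \<bullet> (H (x + r *\<^sub>R h) *v h))" for m :: nat and r :: real
  have 0: "DERIV (d 0) r :> d (Suc 0) r" for r
    unfolding d_def using has_real_derivative_along_line[OF g, of x h r] by simp
  have 1: "DERIV (d (Suc 0)) r :> d (Suc (Suc 0)) r" for r
  proof -
    have "((\<lambda>r. D (x + r *\<^sub>R h) \<bullet> h) has_vector_derivative ((H (x + r *\<^sub>R h) *v h) \<bullet> h)) (at r)"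
      by (intro bounded_linear.has_vector_derivative[OF bounded_linear_inner_left] has_vector_derivative_along_line D)
    moreover have "d (Suc 0) = (\<lambda>r. D (x + r *\<^sub>R h) \<bullet> h)"
      by (simp add: d_def fun_eq_iff)
    ultimately show ?thesis
      by (simp add: d_def has_real_derivative_iff_has_vector_derivative inner_commute)
  qed
  have "\<forall>m t. m < 2 \<and> 0 \<le> t \<and> t \<le> 1 \<longrightarrow> DERIV (d m) t :> d (Suc m) t"
    using 0 1 by (auto simp: less_2_cases_iff)
  from Maclaurin[OF zero_less_one _ refl this]
  obtain \<xi> where "0 < \<xi>" "\<xi> < 1" 
    "d 0 1 = (\<Sum>m<2. d m 0 / fact m * 1 ^ m) + d 2 \<xi> / fact 2 * 1 ^ 2" by auto
  then show thesis
    by (intro that[of \<xi>]) (auto simp: d_def numeral_2_eq_2)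
qed

text \<open>Here \<open>norm M\<close> is the Euclidean norm of the entries, which dominates the
  norm of each row. Cauchy-Schwarz for each row and summing over the rows give the crude factor
  \<open>CARD('n)\<close>.\<close>

lemma abs_inner_matrix_le:
  fixes M :: "real^'n^'n"
  shows "\<bar>h \<bullet> (M *v h)\<bar> \<le> real CARD('n) * norm M * (h \<bullet> h)"
proof -
  have "norm (M *v h) \<le> (\<Sum>i\<in>UNIV. \<bar>(M *v h) $ i\<bar>)"
    by (rule norm_le_l1_cart)
  also have "\<dots> \<le> (\<Sum>i\<in>(UNIV::'n set). norm M * norm h)"
  proof (rule sum_mono)
    fix i
    have "\<bar>(M *v h) $ i\<bar> \<le> norm (M $ i) * norm h"
      by (simp add: matrix_vector_mul_component Cauchy_Schwarz_ineq2)
    also have "\<dots> \<le> norm M * norm h"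
      by (intro mult_right_mono Finite_Cartesian_Product.norm_nth_le) auto
    finally show "\<bar>(M *v h) $ i\<bar> \<le> norm M * norm h" .
  qed
  finally have le: "norm (M *v h) \<le> real CARD('n) * (norm M * norm h)" by simp
  have "\<bar>h \<bullet> (M *v h)\<bar> \<le> norm h * norm (M *v h)"
    by (rule Cauchy_Schwarz_ineq2)
  also have "\<dots> \<le> norm h * (real CARD('n) * (norm M * norm h))"
    by (intro mult_left_mono le) auto
  finally show ?thesis by (simp add: dot_square_norm power2_eq_square mult_ac)
qed

text \<open>Continuity of the Hessian as an estimate of quadratic forms that is uniform in
  \<open>h\<close>. The radius is halved because the distance in the product is bounded by the sum
  of the two distances.\<close>

lemma continuous_matrix_form_close:
  fixes M :: "real^'n \<Rightarrow> real \<Rightarrow> real^'n^'n"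
  assumes "continuous_on UNIV (\<lambda>(x, t). M x t)" "\<eta> > 0"
  obtains \<rho> where "\<rho> > 0"
    "\<And>z s h. norm (z - x) < \<rho> \<Longrightarrow> \<bar>s - t\<bar> < \<rho> \<Longrightarrow>
      \<bar>h \<bullet> (M z s *v h) - h \<bullet> (M x t *v h)\<bar> \<le> \<eta> * (h \<bullet> h)"
proof -
  let ?n = "real CARD('n)"
  have n: "?n > 0" by simp
  have "isCont (\<lambda>(x, t). M x t) (x, t)"
    using assms(1) by (simp add: continuous_on_eq_continuous_at)
  then obtain d where d: "d > 0" "\<And>p. dist p (x, t) < d \<Longrightarrow> dist ((\<lambda>(x, t). M x t) p) (M x t) < \<eta> / ?n"
    unfolding continuous_at_eps_delta using assms(2) n by (metis case_prod_conv divide_pos_pos)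
  have "\<bar>h \<bullet> (M z s *v h) - h \<bullet> (M x t *v h)\<bar> \<le> \<eta> * (h \<bullet> h)"
    if "norm (z - x) < d / 2" "\<bar>s - t\<bar> < d / 2" for z s h
  proof -
    have "dist (z, s) (x, t) \<le> dist z x + dist s t"
      by (simp add: dist_Pair_Pair real_sqrt_sum_squares_triangle_ineq[of _ 0 0, simplified] sqrt_sum_squares_le_sum)
    also have "\<dots> < d" using that by (simp add: dist_norm)
    finally have "norm (M z s - M x t) < \<eta> / ?n"
      using d(2)[of "(z, s)"] by (simp add: dist_norm)
    then have "?n * norm (M z s - M x t) \<le> \<eta>"
      using n by (simp add: field_simps)
    then have "?n * norm (M z s - M x t) * (h \<bullet> h) \<le> \<eta> * (h \<bullet> h)"
      by (intro mult_right_mono) auto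
    then show ?thesis
      using abs_inner_matrix_le[of h "M z s - M x t"]
      by (simp add: matrix_vector_mult_diff_rdistrib inner_diff_right)
  qed
  then show thesis using d(1) that[of "d / 2"] by auto
qed

section \<open>Averages in space and in time\<close>

lemma continuous_on_integral_ball_param:
  fixes g :: "real^'n \<Rightarrow> real \<Rightarrow> real"
  assumes g: "continuous_on UNIV (\<lambda>(y, s). g y s)"
  shows "continuous_on UNIV (\<lambda>s. integral (ball 0 r) (\<lambda>y. g y s))"
proof -
  have sec: "continuous_on UNIV (\<lambda>y. g y s)" for s
    using continuous_on_compose2[OF g, of UNIV "\<lambda>y. (y, s)"]
    by (simp add: continuous_on_Pair continuous_on_id continuous_on_const)
  have sw: "continuous_on (UNIV \<times> cball 0 r) (\<lambda>(s, y). g y s)"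
    using continuous_on_compose2[OF g, of "UNIV \<times> cball 0 r" "\<lambda>p. (snd p, fst p)"]
    by (simp add: continuous_on_Pair continuous_on_fst continuous_on_snd continuous_on_id case_prod_beta')
  define V where "V = measure lebesgue (ball (0::real^'n) r)"
  have V: "V \<ge> 0" by (simp add: V_def)
  show ?thesis
  proof (rule continuous_onI)
    fix s0 e :: real assume e: "e > 0"
    \<comment> \<open>The added 1 keeps the denominator positive when the ball has volume 0, that
      is, for nonpositive \<open>r\<close>. Compactness of the closed ball supplies closeness
      uniform in \<open>y\<close>.\<close>
    define e' where "e' = e / (V + 1)"
    have e': "e' > 0" "e' * V < e" using e V by (auto simp: e'_def field_simps)
    obtain X where X: "s0 \<in> X" "open X"
      and close: "\<forall>s\<in>X \<inter> UNIV. \<forall>y\<in>cball 0 r. dist (g y s) (g y s0) \<le> e'"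
      using continuous_on_prod_compactE[OF sw compact_cball _ e'(1), of s0] by auto
    then obtain d where d: "d > 0" "\<And>s. dist s s0 < d \<Longrightarrow> s \<in> X"
      by (meson open_dist)
    have "dist (integral (ball 0 r) (\<lambda>y. g y s)) (integral (ball 0 r) (\<lambda>y. g y s0)) < e" if "dist s s0 < d" for s
    proof -
      have "norm (integral (ball 0 r) (\<lambda>y. g y s - g y s0)) \<le> integral (ball 0 r) (\<lambda>y::real^'n. e')"
        using close d(2)[OF that]
        by (intro integral_norm_bound_integral integrable_on_ball_continuous continuous_intros sec) (auto simp: dist_norm)
      also have "\<dots> = e' * integral (ball 0 r) (\<lambda>y::real^'n. 1)"
        by (simp flip: integral_mult_right)
      also have "\<dots> = e' * V"
        using lmeasure_integral[of "ball (0::real^'n) r"] by (simp add: V_def)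
      also note e'(2)
      finally show ?thesis
        by (simp add: dist_norm integral_diff integrable_on_ball_continuous sec)
    qed
    with d(1) show "\<exists>d>0. \<forall>s\<in>UNIV. dist s s0 < d \<longrightarrow>
      dist (integral (ball 0 r) (\<lambda>y. g y s)) (integral (ball 0 r) (\<lambda>y. g y s0)) \<le> e"
      by (meson less_imp_le)
  qed
qed

text \<open>The mean of \<open>s - t\<close> over the backward interval is
  \<open>- \<tau> / 2\<close>, the origin of the minus sign before the time derivative.\<close>

lemma has_integral_affine_before:
  fixes k m t \<tau> :: real
  assumes "\<tau> > 0"
  shows "((\<lambda>s. k + m * (s - t)) has_integral (\<tau> * (k - m * \<tau> / 2))) {t - \<tau>..t}"
proof -
  have "((\<lambda>s. k + m * (s - t)) has_integral (k * t + m * (t - t)\<^sup>2 / 2 - (k * (t - \<tau>) + m * (t - \<tau> - t)\<^sup>2 / 2))) {t - \<tau>..t}"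
    using assms by (intro fundamental_theorem_of_calculus)
      (auto intro!: derivative_eq_intros simp flip: has_real_derivative_iff_has_vector_derivative)
  then show ?thesis by (simp add: algebra_simps power2_eq_square)
qed

lemma
  fixes a :: "real \<Rightarrow> real"
  assumes a: "continuous_on UNIV a" and \<tau>: "\<tau> > 0"
  shows time_average_ge_affine:
      "(\<And>s. s \<in> {t - \<tau>..t} \<Longrightarrow> k + m * (s - t) \<le> a s) \<Longrightarrow> k - m * \<tau> / 2 \<le> 1 / \<tau> * integral {t - \<tau>..t} a"
    and time_average_le_affine:
      "(\<And>s. s \<in> {t - \<tau>..t} \<Longrightarrow> a s \<le> k + m * (s - t)) \<Longrightarrow> 1 / \<tau> * integral {t - \<tau>..t} a \<le> k - m * \<tau> / 2"
proof -
  have "a integrable_on {t - \<tau>..t}"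
    using a by (intro integrable_continuous_interval continuous_on_subset[OF a]) auto
  then have ai: "(a has_integral (integral {t - \<tau>..t} a)) {t - \<tau>..t}"
    by (rule integrable_integral)
  note li = has_integral_affine_before[OF \<tau>, of k m t]
  {
    assume "\<And>s. s \<in> {t - \<tau>..t} \<Longrightarrow> k + m * (s - t) \<le> a s"
    from has_integral_le[OF li ai this]
    show "k - m * \<tau> / 2 \<le> 1 / \<tau> * integral {t - \<tau>..t} a"
      using \<tau> by (simp add: pos_le_divide_eq mult.commute)
  next
    assume "\<And>s. s \<in> {t - \<tau>..t} \<Longrightarrow> a s \<le> k + m * (s - t)"
    from has_integral_le[OF ai li this]
    show "1 / \<tau> * integral {t - \<tau>..t} a \<le> k - m * \<tau> / 2"
      using \<tau> by (simp add: pos_divide_le_eq mult.commute)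
  }
qed

section \<open>Expansion of the averaging operator\<close>

definition space_time_average ::
  "real \<Rightarrow> real^'n^'n \<Rightarrow> (real^'n \<Rightarrow> real \<Rightarrow> real) \<Rightarrow> real^'n \<Rightarrow> real \<Rightarrow> real" where
  "space_time_average \<epsilon> A v x t =
     (let \<tau> = real CARD('n) / (real CARD('n) + 2) * \<epsilon>\<^sup>2 in
      (1 / \<tau>) * integral {t - \<tau>..t} (\<lambda>s. (1 / measure lebesgue (ball (0::real^'n) \<epsilon>)) *
        integral (ball 0 \<epsilon>) (\<lambda>y. v (x + A *v y) s)))"

definition admissible :: "real \<Rightarrow> (real^'n^'n) set" where
  "admissible \<theta> = {A. spd A \<and> det A = 1 \<and> mat_le_scalar A \<theta>}"

lemma M_eps_eq:
  fixes v :: "real^'n \<Rightarrow> real \<Rightarrow> real"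
  shows "M_eps \<psi> f \<epsilon> v x t = (INF A\<in>admissible (\<psi> \<epsilon>). space_time_average \<epsilon> A v x t)
    + real CARD('n) / (2 * (real CARD('n) + 2)) * f x t * \<epsilon>\<^sup>2"
  by (simp add: M_eps_def space_time_average_def admissible_def Let_def)

lemma continuous_on_ball_average:
  fixes v :: "real^'n \<Rightarrow> real \<Rightarrow> real" and A :: "real^'n^'n"
  assumes v: "continuous_on UNIV (\<lambda>(x, t). v x t)"
  shows "continuous_on UNIV (\<lambda>y. v (x + A *v y) s)"
    and "continuous_on UNIV (\<lambda>s. 1 / measure lebesgue (ball (0::real^'n) r) *
      integral (ball 0 r) (\<lambda>y. v (x + A *v y) s))"
proof -
  have c: "continuous_on UNIV (\<lambda>(y, s). v (x + A *v y) s)"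
  proof -
    have "continuous_on UNIV (\<lambda>p::(real^'n) \<times> real. A *v fst p)"
      by (rule continuous_on_compose2[OF matrix_vector_mult_linear_continuous_on[of UNIV A]])
         (auto intro: continuous_on_fst continuous_on_id)
    then have "continuous_on UNIV (\<lambda>p::(real^'n) \<times> real. (x + A *v fst p, snd p))"
      by (intro continuous_on_Pair continuous_on_add continuous_on_const continuous_on_snd continuous_on_id)
    from continuous_on_compose2[OF v this] show ?thesis
      by (simp add: case_prod_beta')
  qed
  show "continuous_on UNIV (\<lambda>y. v (x + A *v y) s)"
    using continuous_on_compose2[OF c, of UNIV "\<lambda>y. (y, s)"] by (simp add: continuous_intros)
  show "continuous_on UNIV (\<lambda>s. 1 / measure lebesgue (ball (0::real^'n) r) *
      integral (ball 0 r) (\<lambda>y. v (x + A *v y) s))"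
    by (intro continuous_intros continuous_on_integral_ball_param c)
qed

text \<open>The linear coefficient \<open>b s\<close> may depend on \<open>s\<close> without any
  regularity, since the ball average removes it for every \<open>s\<close> separately. The
  comparison is requested on the simpler interval down to \<open>t - \<epsilon>\<^sup>2\<close>,
  which contains the interval of averaging. The factor 2 before the trace is there because
  \<open>S\<close> will be about half of a Hessian.\<close>

lemma
  fixes v :: "real^'n \<Rightarrow> real \<Rightarrow> real" and S :: "real^'n^'n"
  assumes v: "continuous_on UNIV (\<lambda>(x, t). v x t)" and \<epsilon>: "\<epsilon> > 0"
    and n: "n = real CARD('n)"
  shows space_time_average_ge:
      "(\<And>y s. norm y < \<epsilon> \<Longrightarrow> t - \<epsilon>\<^sup>2 \<le> s \<Longrightarrow> s \<le> t \<Longrightarrow>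
          k + m * (s - t) + b s \<bullet> y + y \<bullet> (S *v y) \<le> v (x + A *v y) s) \<Longrightarrow>
        k + \<epsilon>\<^sup>2 / (2 * (n + 2)) * (2 * trace S - n * m) \<le> space_time_average \<epsilon> A v x t"
    and space_time_average_le:
      "(\<And>y s. norm y < \<epsilon> \<Longrightarrow> t - \<epsilon>\<^sup>2 \<le> s \<Longrightarrow> s \<le> t \<Longrightarrow>
          v (x + A *v y) s \<le> k + m * (s - t) + b s \<bullet> y + y \<bullet> (S *v y)) \<Longrightarrow>
        space_time_average \<epsilon> A v x t \<le> k + \<epsilon>\<^sup>2 / (2 * (n + 2)) * (2 * trace S - n * m)"
proof -
  define \<tau> where "\<tau> = n / (n + 2) * \<epsilon>\<^sup>2"
  have n0: "n > 0" by (simp add: n)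
  have \<tau>: "\<tau> > 0" "\<tau> \<le> \<epsilon>\<^sup>2"
    using \<epsilon> n0 by (auto simp: \<tau>_def field_simps)
  define a where "a s = 1 / measure lebesgue (ball (0::real^'n) \<epsilon>) *
      integral (ball 0 \<epsilon>) (\<lambda>y. v (x + A *v y) s)" for s
  have a: "continuous_on UNIV a"
    unfolding a_def by (rule continuous_on_ball_average[OF v])
  have avg: "space_time_average \<epsilon> A v x t = 1 / \<tau> * integral {t - \<tau>..t} a"
    by (simp add: space_time_average_def a_def[abs_def] \<tau>_def n Let_def)
  have eq: "(k + \<epsilon>\<^sup>2 / (n + 2) * trace S) - m * \<tau> / 2 = k + \<epsilon>\<^sup>2 / (2 * (n + 2)) * (2 * trace S - n * m)"
  proof -
    define E where "E = \<epsilon>\<^sup>2 / (n + 2)"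
    have E: "\<tau> = n * E" "\<epsilon>\<^sup>2 / (2 * (n + 2)) = E / 2"
      by (simp_all add: \<tau>_def E_def)
    show ?thesis
      unfolding E E_def[symmetric] by (simp add: algebra_simps)
  qed
  {
    assume *: "\<And>y s. norm y < \<epsilon> \<Longrightarrow> t - \<epsilon>\<^sup>2 \<le> s \<Longrightarrow> s \<le> t \<Longrightarrow>
          k + m * (s - t) + b s \<bullet> y + y \<bullet> (S *v y) \<le> v (x + A *v y) s"
    have "(k + \<epsilon>\<^sup>2 / (n + 2) * trace S) + m * (s - t) \<le> a s" if "s \<in> {t - \<tau>..t}" for s
      using ball_average_ge_quadratic[OF continuous_on_ball_average(1)[OF v] \<epsilon>, of "k + m * (s - t)" "b s" S x A s]
        *[of _ s] that \<tau> by (simp add: a_def n)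
    from time_average_ge_affine[OF a \<tau>(1) this]
    show "k + \<epsilon>\<^sup>2 / (2 * (n + 2)) * (2 * trace S - n * m) \<le> space_time_average \<epsilon> A v x t"
      unfolding avg eq .
  next
    assume *: "\<And>y s. norm y < \<epsilon> \<Longrightarrow> t - \<epsilon>\<^sup>2 \<le> s \<Longrightarrow> s \<le> t \<Longrightarrow>
          v (x + A *v y) s \<le> k + m * (s - t) + b s \<bullet> y + y \<bullet> (S *v y)"
    have "a s \<le> (k + \<epsilon>\<^sup>2 / (n + 2) * trace S) + m * (s - t)" if "s \<in> {t - \<tau>..t}" for s
      using ball_average_le_quadratic[OF continuous_on_ball_average(1)[OF v] \<epsilon>, of x A s "k + m * (s - t)" "b s" S]
        *[of _ s] that \<tau> by (simp add: a_def n)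
    from time_average_le_affine[OF a \<tau>(1) this]
    show "space_time_average \<epsilon> A v x t \<le> k + \<epsilon>\<^sup>2 / (2 * (n + 2)) * (2 * trace S - n * m)"
      unfolding avg eq .
  }
qed

lemma trace_scaleR: "trace (c *\<^sub>R (S :: real^'n^'n)) = c * trace S"
  by (simp add: trace_def sum_distrib_left)

text \<open>For \<open>s \<le> t\<close> the increment \<open>s - t\<close> is not positive, so the
  larger slope gives the lower bound and the smaller slope the upper one.\<close>

lemma real_derivative_backward_bound:
  fixes p :: "real \<Rightarrow> real"
  assumes "(p has_real_derivative p') (at t)" "\<eta> > 0"
  obtains \<rho> where "\<rho> > 0"
    "\<And>s. t - \<rho> < s \<Longrightarrow> s \<le> t \<Longrightarrow> p t + (p' + \<eta>) * (s - t) \<le> p s \<and> p s \<le> p t + (p' - \<eta>) * (s - t)"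
proof -
  obtain d where d: "d > 0" "\<And>s. norm (s - t) < d \<Longrightarrow> norm (p s - p t - p' * (s - t)) \<le> \<eta> * norm (s - t)"
    using assms unfolding has_field_derivative_def has_derivative_at_alt by blast
  have "p t + (p' + \<eta>) * (s - t) \<le> p s \<and> p s \<le> p t + (p' - \<eta>) * (s - t)" if "t - d < s" "s \<le> t" for s
  proof -
    have "\<bar>p s - p t - p' * (s - t)\<bar> \<le> \<eta> * (t - s)"
      using d(2)[of s] that by simp
    then show ?thesis by (auto simp: abs_le_iff algebra_simps)
  qed
  with d(1) show thesis by (rule that)
qed

section \<open>Expansion for a fixed test function\<close>

context
  fixes \<phi> :: "real^'n \<Rightarrow> real \<Rightarrow> real" and D\<phi> D2\<phi> \<phi>t
  assumes test: "C21_convex_test \<phi> D\<phi> D2\<phi> \<phi>t"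
begin

lemma
  shows test_gradient: "((\<lambda>y. \<phi> y t) has_derivative (\<lambda>h. D\<phi> x t \<bullet> h)) (at x)"
    and test_hessian: "((\<lambda>y. D\<phi> y t) has_derivative (\<lambda>h. D2\<phi> x t *v h)) (at x)"
    and test_time: "((\<lambda>s. \<phi> x s) has_real_derivative \<phi>t x t) (at t)"
    and test_continuous: "continuous_on UNIV (\<lambda>(x, t). \<phi> x t)"
    and test_hessian_continuous: "continuous_on UNIV (\<lambda>(x, t). D2\<phi> x t)"
    and test_convex: "convex_on UNIV (\<lambda>x. \<phi> x t)"
  using test by (simp_all add: C21_convex_test_def)

lemma test_hessian_psd: "psd (D2\<phi> x t)"
  by (rule convex_hessian_psd[OF test_gradient test_hessian test_convex])

text \<open>Value and gradient stay at time \<open>s\<close>: the value is compared with time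
  \<open>t\<close> by the time derivative, and the gradient disappears in the average. Only the
  Hessian is moved to \<open>(x, t)\<close>, at the cost of the error term.\<close>

lemma test_taylor:
  assumes "\<eta> > 0"
  obtains \<rho> where "\<rho> > 0"
    "\<And>h s. norm h < \<rho> \<Longrightarrow> \<bar>s - t\<bar> < \<rho> \<Longrightarrow>
      \<bar>\<phi> (x + h) s - (\<phi> x s + D\<phi> x s \<bullet> h + 1/2 * (h \<bullet> (D2\<phi> x t *v h)))\<bar> \<le> \<eta> * (h \<bullet> h)"
proof -
  obtain \<rho> where \<rho>: "\<rho> > 0" "\<And>z s h. norm (z - x) < \<rho> \<Longrightarrow> \<bar>s - t\<bar> < \<rho> \<Longrightarrow>
      \<bar>h \<bullet> (D2\<phi> z s *v h) - h \<bullet> (D2\<phi> x t *v h)\<bar> \<le> (2 * \<eta>) * (h \<bullet> h)"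
    using continuous_matrix_form_close[OF test_hessian_continuous, of "2 * \<eta>" x t] assms by auto
  have "\<bar>\<phi> (x + h) s - (\<phi> x s + D\<phi> x s \<bullet> h + 1/2 * (h \<bullet> (D2\<phi> x t *v h)))\<bar> \<le> \<eta> * (h \<bullet> h)"
    if "norm h < \<rho>" "\<bar>s - t\<bar> < \<rho>" for h :: "real^'n" and s
  proof -
    obtain \<xi> where \<xi>: "0 < \<xi>" "\<xi> < 1"
      "\<phi> (x + h) s = \<phi> x s + D\<phi> x s \<bullet> h + 1/2 * (h \<bullet> (D2\<phi> (x + \<xi> *\<^sub>R h) s *v h))"
      by (rule taylor_second_order[OF test_gradient test_hessian])
    have "norm (\<xi> *\<^sub>R h) \<le> norm h"
      using \<xi> by (simp add: mult_left_le_one_le)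
    then have "\<bar>h \<bullet> (D2\<phi> (x + \<xi> *\<^sub>R h) s *v h) - h \<bullet> (D2\<phi> x t *v h)\<bar> \<le> (2 * \<eta>) * (h \<bullet> h)"
      using that by (intro \<rho>) auto
    then show ?thesis unfolding \<xi>(3) by (simp add: abs_le_iff)
  qed
  with \<rho>(1) show thesis by (rule that)
qed

text \<open>The error of the Taylor expansion along \<open>A\<close> is only \<open>o(\<psi>(\<epsilon>)\<^sup>2 \<epsilon>\<^sup>2)\<close>, which need not be
  \<open>o(\<epsilon>\<^sup>2)\<close>. If the Hessian is positive definite, the error is absorbed into the Hessian term;
  otherwise its determinant vanishes and convexity alone suffices.\<close>

lemma test_lower_taylor:
  assumes \<eta>: "0 < \<eta>" "\<eta> < 1"
  obtains \<rho> \<kappa> where "\<rho> > 0" "0 \<le> \<kappa>"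
    "\<kappa> * root CARD('n) (det (D2\<phi> x t)) = (1 - \<eta>) * root CARD('n) (det (D2\<phi> x t))"
    "\<And>h s. norm h < \<rho> \<Longrightarrow> \<bar>s - t\<bar> < \<rho> \<Longrightarrow>
      \<phi> x s + D\<phi> x s \<bullet> h + \<kappa> / 2 * (h \<bullet> (D2\<phi> x t *v h)) \<le> \<phi> (x + h) s"
proof (cases "det (D2\<phi> x t) = 0")
  case True
  show thesis
    \<comment> \<open>The witnesses are \<open>\<rho> = 1\<close> and \<open>\<kappa> = 0\<close>:
      both sides of the equation for \<open>\<kappa>\<close> vanish with the determinant, and the
      bound is the tangent plane at time \<open>s\<close>.\<close>
    using True convex_above_tangent_plane[OF test_convex test_gradient]
    by (intro that[of 1 0]) auto
next
  case False
  then obtain m where m: "m > 0" "\<And>v. m * (v \<bullet> v) \<le> v \<bullet> (D2\<phi> x t *v v)"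
    using psd_coercive[OF test_hessian_psd] by blast
  \<comment> \<open>The tolerance \<open>\<eta> * m / 2\<close> is such that, by coercivity, the
    error is at most the fraction \<open>\<eta>\<close> of the Hessian term; this leaves
    \<open>\<kappa> = 1 - \<eta>\<close>.\<close>
  obtain \<rho> where \<rho>: "\<rho> > 0" "\<And>h s. norm h < \<rho> \<Longrightarrow> \<bar>s - t\<bar> < \<rho> \<Longrightarrow>
      \<bar>\<phi> (x + h) s - (\<phi> x s + D\<phi> x s \<bullet> h + 1/2 * (h \<bullet> (D2\<phi> x t *v h)))\<bar> \<le> (\<eta> * m / 2) * (h \<bullet> h)"
    using test_taylor[where \<eta> = "\<eta> * m / 2" and x = x and t = t] \<eta> m(1) by auto
  show thesis
  proof (rule that[of \<rho> "1 - \<eta>"])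
    fix h :: "real^'n" and s assume "norm h < \<rho>" "\<bar>s - t\<bar> < \<rho>"
    then have "\<phi> x s + D\<phi> x s \<bullet> h + 1/2 * (h \<bullet> (D2\<phi> x t *v h)) - (\<eta> * m / 2) * (h \<bullet> h) \<le> \<phi> (x + h) s"
      using abs_le_D2[OF \<rho>(2)[of h s]] by linarith
    moreover have "(\<eta> / 2) * (m * (h \<bullet> h)) \<le> (\<eta> / 2) * (h \<bullet> (D2\<phi> x t *v h))"
      using \<eta> by (intro mult_left_mono m) auto
    ultimately show "\<phi> x s + D\<phi> x s \<bullet> h + (1 - \<eta>) / 2 * (h \<bullet> (D2\<phi> x t *v h)) \<le> \<phi> (x + h) s"
      by (simp add: algebra_simps diff_divide_distrib)
  qed (use \<rho> \<eta> in auto)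
qed

text \<open>The threshold for \<open>\<epsilon>\<close> is the same for all admissible matrices: it
  only asks that \<open>\<epsilon>\<^sup>2\<close> and \<open>\<epsilon> * \<psi> \<epsilon>\<close>
  be small, and the latter bounds \<open>norm (A *v y)\<close> whatever \<open>A\<close> is.\<close>

lemma test_average_lower:
  assumes \<psi>: "((\<lambda>\<epsilon>. \<epsilon> * \<psi> \<epsilon>) \<longlongrightarrow> 0) (at_right 0)" "\<forall>\<epsilon>>0. \<psi> \<epsilon> > 0"
    and \<eta>: "0 < \<eta>" "\<eta> < 1" and n: "n = real CARD('n)"
  shows "\<forall>\<^sub>F \<epsilon> in at_right 0. \<forall>A\<in>admissible (\<psi> \<epsilon>).
    \<phi> x t + \<epsilon>\<^sup>2 * (n / (2 * (n + 2)) * ((1 - \<eta>) * root CARD('n) (det (D2\<phi> x t)) - \<phi>t x t - \<eta>))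
      \<le> space_time_average \<epsilon> A \<phi> x t"
proof -
  let ?H = "D2\<phi> x t" and ?R = "root CARD('n) (det (D2\<phi> x t))"
  obtain \<rho> \<kappa> where \<rho>: "\<rho> > 0" and \<kappa>: "0 \<le> \<kappa>" "\<kappa> * ?R = (1 - \<eta>) * ?R"
    and taylor: "\<And>h s. norm h < \<rho> \<Longrightarrow> \<bar>s - t\<bar> < \<rho> \<Longrightarrow>
      \<phi> x s + D\<phi> x s \<bullet> h + \<kappa> / 2 * (h \<bullet> (?H *v h)) \<le> \<phi> (x + h) s"
    using test_lower_taylor[OF \<eta>, where x = x and t = t] by blast
  obtain \<sigma> where \<sigma>: "\<sigma> > 0" and time: "\<And>s. t - \<sigma> < s \<Longrightarrow> s \<le> t \<Longrightarrow>
      \<phi> x t + (\<phi>t x t + \<eta>) * (s - t) \<le> \<phi> x s \<and> \<phi> x s \<le> \<phi> x t + (\<phi>t x t - \<eta>) * (s - t)"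
    using real_derivative_backward_bound[OF test_time[where x = x and t = t] \<eta>(1)] by blast
  have "((\<lambda>\<epsilon>::real. \<epsilon>\<^sup>2) \<longlongrightarrow> 0\<^sup>2) (at_right 0)"
    by (intro tendsto_intros)
  then have "\<forall>\<^sub>F \<epsilon>::real in at_right 0. \<epsilon>\<^sup>2 < min \<rho> \<sigma>"
    using \<rho> \<sigma> by (intro order_tendstoD) auto
  moreover have "\<forall>\<^sub>F \<epsilon> in at_right 0. \<epsilon> * \<psi> \<epsilon> < \<rho>"
    using \<psi>(1) \<rho> by (intro order_tendstoD) auto
  ultimately show ?thesis
    using eventually_at_right_less[of 0]
  proof (eventually_elim, intro ballI)
    fix \<epsilon> :: real and A :: "real^'n^'n"
    assume \<epsilon>2: "\<epsilon>\<^sup>2 < min \<rho> \<sigma>" and \<epsilon>\<psi>: "\<epsilon> * \<psi> \<epsilon> < \<rho>" and \<epsilon>: "0 < \<epsilon>" and A: "A \<in> admissible (\<psi> \<epsilon>)"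
    define S where "S = (\<kappa> / 2) *\<^sub>R (transpose A ** ?H ** A)"
    have det: "det A = 1" and norm: "norm (A *v y) \<le> \<psi> \<epsilon> * norm y" for y
      using A \<psi>(2) \<epsilon> spd_norm_le[of A "\<psi> \<epsilon>" y] by (auto simp: admissible_def)
    have "\<phi> x t + \<epsilon>\<^sup>2 / (2 * (n + 2)) * (2 * trace S - n * (\<phi>t x t + \<eta>)) \<le> space_time_average \<epsilon> A \<phi> x t"
    proof (rule space_time_average_ge[OF test_continuous \<epsilon> n])
      fix y :: "real^'n" and s assume y: "norm y < \<epsilon>" and s: "t - \<epsilon>\<^sup>2 \<le> s" "s \<le> t"
      have "norm (A *v y) \<le> \<psi> \<epsilon> * norm y" by (rule norm)
      also have "\<dots> \<le> \<psi> \<epsilon> * \<epsilon>" using y \<psi>(2) \<epsilon> by (intro mult_left_mono) (auto simp: less_imp_le)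
      also have "\<dots> < \<rho>" using \<epsilon>\<psi> by (simp add: mult.commute)
      finally have "norm (A *v y) < \<rho>" .
      moreover have "\<bar>s - t\<bar> < \<rho>" "t - \<sigma> < s" using s \<epsilon>2 by auto
      moreover have "y \<bullet> (S *v y) = \<kappa> / 2 * ((A *v y) \<bullet> (?H *v (A *v y)))"
        by (simp add: S_def inner_congruence flip: scaleR_matrix_vector_assoc)
      moreover have "(transpose A *v D\<phi> x s) \<bullet> y = D\<phi> x s \<bullet> (A *v y)"
        by (simp add: dot_lmul_matrix)
      ultimately show "\<phi> x t + (\<phi>t x t + \<eta>) * (s - t) + (transpose A *v D\<phi> x s) \<bullet> y + y \<bullet> (S *v y)
          \<le> \<phi> (x + A *v y) s"
        using taylor[of "A *v y" s] time[of s] s(2) by simp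
    qed
    moreover have "n * ((1 - \<eta>) * ?R) \<le> 2 * trace S"
    proof -
      \<comment> \<open>Multiplying the trace inequality by \<open>\<kappa>\<close> treats singular
        and definite Hessians together: in both cases \<open>\<kappa> * ?R\<close> equals
        \<open>(1 - \<eta>) * ?R\<close>.\<close>
      have "\<kappa> * (n * ?R) \<le> \<kappa> * trace (transpose A ** ?H ** A)"
        unfolding n by (intro mult_left_mono \<kappa>(1) trace_congruence_ge_root_det test_hessian_psd det)
      then show ?thesis
        using \<kappa>(2) by (simp add: S_def trace_scaleR mult.left_commute[of \<kappa> n])
    qed
    moreover have "0 \<le> \<epsilon>\<^sup>2 / (2 * (n + 2))" by (simp add: n)
    ultimately have "\<phi> x t + \<epsilon>\<^sup>2 / (2 * (n + 2)) * (n * ((1 - \<eta>) * ?R) - n * (\<phi>t x t + \<eta>))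
        \<le> space_time_average \<epsilon> A \<phi> x t"
      by (smt (verit) mult_left_mono)
    also have "\<epsilon>\<^sup>2 / (2 * (n + 2)) * (n * ((1 - \<eta>) * ?R) - n * (\<phi>t x t + \<eta>)) =
        \<epsilon>\<^sup>2 * (n / (2 * (n + 2)) * ((1 - \<eta>) * ?R - \<phi>t x t - \<eta>))"
      by (simp add: algebra_simps)
    finally show "\<phi> x t + \<epsilon>\<^sup>2 * (n / (2 * (n + 2)) * ((1 - \<eta>) * ?R - \<phi>t x t - \<eta>)) \<le> space_time_average \<epsilon> A \<phi> x t" .
  qed
qed

text \<open>The matrix is chosen before \<open>\<epsilon>\<close>, so it is eventually admissible
  and the Taylor error may depend on it. The three \<open>\<eta>\<close> stem from the near
  minimality of the trace, the Taylor error and the time derivative.\<close>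

lemma test_average_upper:
  assumes \<psi>: "filterlim \<psi> at_top (at_right 0)" and \<eta>: "0 < \<eta>" and n: "n = real CARD('n)"
  obtains A where "\<forall>\<^sub>F \<epsilon> in at_right 0. A \<in> admissible (\<psi> \<epsilon>)"
    "\<forall>\<^sub>F \<epsilon> in at_right 0. space_time_average \<epsilon> A \<phi> x t \<le>
      \<phi> x t + \<epsilon>\<^sup>2 * (n / (2 * (n + 2)) * (root CARD('n) (det (D2\<phi> x t)) - \<phi>t x t + 3 * \<eta>))"
proof -
  let ?H = "D2\<phi> x t" and ?R = "root CARD('n) (det (D2\<phi> x t))"
  have n1: "n \<ge> 1" using zero_less_card_finite[where 'a='n] by (simp add: n)
  obtain A where A: "spd A" "det A = 1" and trA: "trace (transpose A ** ?H ** A) \<le> n * (?R + \<eta>)"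
    using trace_congruence_near_root_det[OF test_hessian_psd \<eta>, of x t] unfolding n by blast
  define C where "C = n * norm A"
  have "mat_le_scalar A \<theta>" if "C \<le> \<theta>" for \<theta>
    unfolding mat_le_scalar_def
  proof
    fix v
    have "v \<bullet> (A *v v) \<le> C * (v \<bullet> v)"
      using abs_inner_matrix_le[of v A] by (simp add: C_def n abs_le_iff)
    also have "\<dots> \<le> \<theta> * (v \<bullet> v)" using that by (intro mult_right_mono) auto
    finally show "v \<bullet> (A *v v) \<le> \<theta> * (v \<bullet> v)" .
  qed
  then have adm: "\<forall>\<^sub>F \<epsilon> in at_right 0. A \<in> admissible (\<psi> \<epsilon>)"
    using A \<psi>[unfolded filterlim_at_top, rule_format, of C]
    by (auto simp: admissible_def elim: eventually_mono)
  \<comment> \<open>The squared Euclidean norm of \<open>A\<close>, written as a congruence of the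
    identity so that the trace inequality yields \<open>T \<ge> 0\<close> and
    \<open>inner_congruence\<close> applies to the error term.\<close>
  define T where "T = trace (transpose A ** mat 1 ** A)"
  have T: "T \<ge> 0"
  proof -
    have "psd (mat 1 :: real^'n^'n)" by (simp add: psd_def)
    from trace_congruence_ge_root_det[OF this A(2)] show ?thesis by (simp add: T_def)
  qed
  \<comment> \<open>A Taylor error \<open>\<delta> * (h \<bullet> h)\<close> with
    \<open>h = A *v y\<close> adds \<open>2 * \<delta> * T\<close> to \<open>2 * trace S\<close>;
    this choice keeps that below \<open>\<eta>\<close>.\<close>
  define \<delta> where "\<delta> = \<eta> / (2 * (T + 1))"
  have \<delta>: "\<delta> > 0" "2 * \<delta> * T \<le> \<eta>" using \<eta> T by (auto simp: \<delta>_def field_simps)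
  obtain \<rho> where \<rho>: "\<rho> > 0" and taylor: "\<And>h s. norm h < \<rho> \<Longrightarrow> \<bar>s - t\<bar> < \<rho> \<Longrightarrow>
      \<bar>\<phi> (x + h) s - (\<phi> x s + D\<phi> x s \<bullet> h + 1/2 * (h \<bullet> (?H *v h)))\<bar> \<le> \<delta> * (h \<bullet> h)"
    using test_taylor[OF \<delta>(1), where x = x and t = t] by blast
  obtain \<sigma> where \<sigma>: "\<sigma> > 0" and time: "\<And>s. t - \<sigma> < s \<Longrightarrow> s \<le> t \<Longrightarrow>
      \<phi> x t + (\<phi>t x t + \<eta>) * (s - t) \<le> \<phi> x s \<and> \<phi> x s \<le> \<phi> x t + (\<phi>t x t - \<eta>) * (s - t)"
    using real_derivative_backward_bound[OF test_time[where x = x and t = t] \<eta>] by blast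
  have "((\<lambda>\<epsilon>::real. \<epsilon>\<^sup>2) \<longlongrightarrow> 0\<^sup>2) (at_right 0)"
    by (intro tendsto_intros)
  then have "\<forall>\<^sub>F \<epsilon>::real in at_right 0. \<epsilon>\<^sup>2 < min \<rho> \<sigma>"
    using \<rho> \<sigma> by (intro order_tendstoD) auto
  moreover have "((\<lambda>\<epsilon>. (\<bar>C\<bar> + 1) * \<epsilon>) \<longlongrightarrow> (\<bar>C\<bar> + 1) * 0) (at_right 0)"
    by (intro tendsto_intros)
  then have "\<forall>\<^sub>F \<epsilon> in at_right 0. (\<bar>C\<bar> + 1) * \<epsilon> < \<rho>"
    using \<rho> by (intro order_tendstoD) auto
  ultimately have "\<forall>\<^sub>F \<epsilon> in at_right 0. space_time_average \<epsilon> A \<phi> x t \<le>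
      \<phi> x t + \<epsilon>\<^sup>2 * (n / (2 * (n + 2)) * (?R - \<phi>t x t + 3 * \<eta>))"
    using eventually_at_right_less[of 0]
  proof eventually_elim
    fix \<epsilon> :: real
    assume \<epsilon>2: "\<epsilon>\<^sup>2 < min \<rho> \<sigma>" and \<epsilon>C: "(\<bar>C\<bar> + 1) * \<epsilon> < \<rho>" and \<epsilon>: "0 < \<epsilon>"
    define S where "S = (1/2) *\<^sub>R (transpose A ** ?H ** A) + \<delta> *\<^sub>R (transpose A ** mat 1 ** A)"
    \<comment> \<open>\<open>spd_norm_le\<close> asks for a positive bound, which
      \<open>\<bar>C\<bar> + 1\<close> certainly is.\<close>
    have leC: "mat_le_scalar A (\<bar>C\<bar> + 1)"
      using \<open>\<And>\<theta>. C \<le> \<theta> \<Longrightarrow> mat_le_scalar A \<theta>\<close> by simp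
    have "space_time_average \<epsilon> A \<phi> x t \<le> \<phi> x t + \<epsilon>\<^sup>2 / (2 * (n + 2)) * (2 * trace S - n * (\<phi>t x t - \<eta>))"
    proof (rule space_time_average_le[OF test_continuous \<epsilon> n])
      fix y :: "real^'n" and s assume y: "norm y < \<epsilon>" and s: "t - \<epsilon>\<^sup>2 \<le> s" "s \<le> t"
      have "norm (A *v y) \<le> (\<bar>C\<bar> + 1) * norm y"
        by (rule spd_norm_le[OF A(1) leC]) simp
      also have "\<dots> \<le> (\<bar>C\<bar> + 1) * \<epsilon>" using y by (intro mult_left_mono) auto
      also note \<epsilon>C
      finally have "norm (A *v y) < \<rho>" .
      moreover have "\<bar>s - t\<bar> < \<rho>" "t - \<sigma> < s" using s \<epsilon>2 by auto
      moreover have "y \<bullet> (S *v y) = 1/2 * ((A *v y) \<bullet> (?H *v (A *v y))) + \<delta> * ((A *v y) \<bullet> (A *v y))"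
        unfolding S_def matrix_vector_mult_add_rdistrib scaleR_matrix_vector_assoc[symmetric]
          inner_add_right inner_scaleR_right inner_congruence by simp
      moreover have "(transpose A *v D\<phi> x s) \<bullet> y = D\<phi> x s \<bullet> (A *v y)"
        by (simp add: dot_lmul_matrix)
      ultimately show "\<phi> (x + A *v y) s \<le>
          \<phi> x t + (\<phi>t x t - \<eta>) * (s - t) + (transpose A *v D\<phi> x s) \<bullet> y + y \<bullet> (S *v y)"
        using taylor[of "A *v y" s] time[of s] s(2) by (simp add: abs_le_iff)
    qed
    moreover have "2 * trace S \<le> n * (?R + 2 * \<eta>)"
    proof -
      have "2 * trace S = trace (transpose A ** ?H ** A) + 2 * \<delta> * T"
        unfolding S_def T_def trace_add trace_scaleR by simp
      also have "\<dots> \<le> n * (?R + \<eta>) + n * \<eta>"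
      proof (rule add_mono[OF trA])
        have "1 * \<eta> \<le> n * \<eta>" using n1 \<eta> by (intro mult_right_mono) auto
        with \<delta>(2) show "2 * \<delta> * T \<le> n * \<eta>" by simp
      qed
      finally show ?thesis by (simp add: algebra_simps)
    qed
    moreover have "0 \<le> \<epsilon>\<^sup>2 / (2 * (n + 2))" using n1 by simp
    ultimately have "space_time_average \<epsilon> A \<phi> x t \<le>
        \<phi> x t + \<epsilon>\<^sup>2 / (2 * (n + 2)) * (n * (?R + 2 * \<eta>) - n * (\<phi>t x t - \<eta>))"
      by (smt (verit) mult_left_mono)
    also have "\<epsilon>\<^sup>2 / (2 * (n + 2)) * (n * (?R + 2 * \<eta>) - n * (\<phi>t x t - \<eta>)) =
        \<epsilon>\<^sup>2 * (n / (2 * (n + 2)) * (?R - \<phi>t x t + 3 * \<eta>))"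
      by (simp add: algebra_simps)
    finally show "space_time_average \<epsilon> A \<phi> x t \<le>
        \<phi> x t + \<epsilon>\<^sup>2 * (n / (2 * (n + 2)) * (?R - \<phi>t x t + 3 * \<eta>))" .
  qed
  with adm show thesis by (rule that)
qed

theorem M_eps_expansion:
  assumes \<psi>: "filterlim \<psi> at_top (at_right 0)" "((\<lambda>\<epsilon>. \<epsilon> * \<psi> \<epsilon>) \<longlongrightarrow> 0) (at_right 0)" "\<forall>\<epsilon>>0. \<psi> \<epsilon> > 0"
  shows "((\<lambda>\<epsilon>. (M_eps \<psi> f \<epsilon> \<phi> x t - \<phi> x t) / \<epsilon>\<^sup>2) \<longlongrightarrow>
    real CARD('n) / (2 * (real CARD('n) + 2)) *
      (root CARD('n) (det (D2\<phi> x t)) - \<phi>t x t + f x t)) (at_right 0)"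
proof (rule tendstoI)
  define n where n: "n = real CARD('n)"
  define c where "c = n / (2 * (n + 2))"
  define R where "R = root CARD('n) (det (D2\<phi> x t))"
  have R: "R \<ge> 0" unfolding R_def using psd_det_nonneg[OF test_hessian_psd] by simp
  have c: "0 < c" "c \<le> 1" by (auto simp: c_def n field_simps)
  fix e :: real assume e: "e > 0"
  \<comment> \<open>The lower estimate is off by \<open>\<eta> * (R + 1)\<close>, the upper one by
    \<open>3 * \<eta>\<close>, both times \<open>c \<le> 1\<close>; the first is to be at most
    \<open>e / 4\<close> and the second at most \<open>3 * e / 4\<close>. The cap \<open>1/2\<close>
    ensures \<open>\<eta> < 1\<close>.\<close>
  define \<eta> where "\<eta> = min (1/2) (e / (4 * (R + 1)))"
  have \<eta>: "0 < \<eta>" "\<eta> < 1" using e R by (auto simp: \<eta>_def)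
  have "\<eta> * (R + 1) \<le> e / (4 * (R + 1)) * (R + 1)"
    using R by (intro mult_right_mono) (auto simp: \<eta>_def)
  also have "\<dots> = e / 4" using R by (simp add: field_simps)
  finally have \<eta>R: "\<eta> * (R + 1) \<le> e / 4" .
  moreover have "\<eta> * 1 \<le> \<eta> * (R + 1)" using R \<eta> by (intro mult_left_mono) auto
  ultimately have \<eta>e: "\<eta> \<le> e / 4" by simp
  obtain A where A: "\<forall>\<^sub>F \<epsilon> in at_right 0. A \<in> admissible (\<psi> \<epsilon>)"
    and up: "\<forall>\<^sub>F \<epsilon> in at_right 0. space_time_average \<epsilon> A \<phi> x t \<le> \<phi> x t + \<epsilon>\<^sup>2 * (c * (R - \<phi>t x t + 3 * \<eta>))"
    using test_average_upper[OF \<psi>(1) \<eta>(1) n, of x t] unfolding c_def R_def by blast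
  have low: "\<forall>\<^sub>F \<epsilon> in at_right 0. \<forall>A\<in>admissible (\<psi> \<epsilon>).
      \<phi> x t + \<epsilon>\<^sup>2 * (c * ((1 - \<eta>) * R - \<phi>t x t - \<eta>)) \<le> space_time_average \<epsilon> A \<phi> x t"
    unfolding c_def R_def by (rule test_average_lower[OF \<psi>(2,3) \<eta> n])
  show "\<forall>\<^sub>F \<epsilon> in at_right 0. dist ((M_eps \<psi> f \<epsilon> \<phi> x t - \<phi> x t) / \<epsilon>\<^sup>2)
    (real CARD('n) / (2 * (real CARD('n) + 2)) *
      (root CARD('n) (det (D2\<phi> x t)) - \<phi>t x t + f x t)) < e"
    unfolding n[symmetric] c_def[symmetric] R_def[symmetric]
    using A up low eventually_at_right_less[of 0]
  proof eventually_elim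
    fix \<epsilon> :: real
    assume A: "A \<in> admissible (\<psi> \<epsilon>)"
      and up: "space_time_average \<epsilon> A \<phi> x t \<le> \<phi> x t + \<epsilon>\<^sup>2 * (c * (R - \<phi>t x t + 3 * \<eta>))"
      and low: "\<forall>A\<in>admissible (\<psi> \<epsilon>). \<phi> x t + \<epsilon>\<^sup>2 * (c * ((1 - \<eta>) * R - \<phi>t x t - \<eta>)) \<le> space_time_average \<epsilon> A \<phi> x t"
      and \<epsilon>: "0 < \<epsilon>"
    define I where "I = (INF A\<in>admissible (\<psi> \<epsilon>). space_time_average \<epsilon> A \<phi> x t)"
    define q where "q = (I - \<phi> x t) / \<epsilon>\<^sup>2"
    \<comment> \<open>The infimum of reals behaves well only for nonempty sets bounded below: the
      uniform lower estimate provides the bound and the fixed matrix \<open>A\<close> the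
      element.\<close>
    have "I \<le> space_time_average \<epsilon> A \<phi> x t"
      unfolding I_def using low by (intro cINF_lower A bdd_belowI2) auto
    with up have "I \<le> \<phi> x t + \<epsilon>\<^sup>2 * (c * (R - \<phi>t x t + 3 * \<eta>))" by simp
    then have 1: "q \<le> c * (R - \<phi>t x t + 3 * \<eta>)"
      unfolding q_def using \<epsilon> by (simp add: pos_divide_le_eq mult.commute)
    have "\<phi> x t + \<epsilon>\<^sup>2 * (c * ((1 - \<eta>) * R - \<phi>t x t - \<eta>)) \<le> I"
      unfolding I_def using A low by (intro cINF_greatest) auto
    then have 2: "c * ((1 - \<eta>) * R - \<phi>t x t - \<eta>) \<le> q"
      unfolding q_def using \<epsilon> by (simp add: pos_le_divide_eq mult.commute)
    have quot: "(M_eps \<psi> f \<epsilon> \<phi> x t - \<phi> x t) / \<epsilon>\<^sup>2 = q + c * f x t"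
      unfolding M_eps_eq I_def[symmetric] q_def c_def n using \<epsilon> by (simp add: field_simps)
    have "c * (3 * \<eta>) \<le> 1 * (3 * \<eta>)" "c * (\<eta> * (R + 1)) \<le> 1 * (\<eta> * (R + 1))"
      using c \<eta> R by (auto intro!: mult_right_mono)
    with \<eta>R \<eta>e have "c * (3 * \<eta>) < e" "c * (\<eta> * (R + 1)) < e" using e by auto
    with 1 2 show "dist ((M_eps \<psi> f \<epsilon> \<phi> x t - \<phi> x t) / \<epsilon>\<^sup>2) (c * (R - \<phi>t x t + f x t)) < e"
      unfolding quot dist_real_def abs_less_iff by (simp add: algebra_simps)
  qed
qed

end

section \<open>From the expansion to the viscosity inequalities\<close>

lemma tendsto_positive_part_zero_iff:
  fixes g :: "real \<Rightarrow> real"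
  assumes "((\<lambda>\<epsilon>. g \<epsilon> / \<epsilon>\<^sup>2) \<longlongrightarrow> L) (at_right 0)"
  shows "((\<lambda>\<epsilon>. max 0 (g \<epsilon>) / \<epsilon>\<^sup>2) \<longlongrightarrow> 0) (at_right 0) \<longleftrightarrow> L \<le> 0"
proof -
  have "((\<lambda>\<epsilon>. max 0 (g \<epsilon> / \<epsilon>\<^sup>2)) \<longlongrightarrow> max 0 L) (at_right 0)"
    by (intro tendsto_intros assms)
  \<comment> \<open>Dividing by a square commutes with the positive part, also at
    \<open>\<epsilon> = 0\<close>, where both quotients are 0. By continuity of the positive part,
    the one-sided condition depends only on the sign of \<open>L\<close>.\<close>
  moreover have "max 0 (g \<epsilon> / \<epsilon>\<^sup>2) = max 0 (g \<epsilon>) / \<epsilon>\<^sup>2" for \<epsilon>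
    by (auto simp: max_def divide_le_0_iff zero_le_divide_iff)
  ultimately have lim: "((\<lambda>\<epsilon>. max 0 (g \<epsilon>) / \<epsilon>\<^sup>2) \<longlongrightarrow> max 0 L) (at_right 0)"
    by simp
  have "((\<lambda>\<epsilon>. max 0 (g \<epsilon>) / \<epsilon>\<^sup>2) \<longlongrightarrow> 0) (at_right 0) \<longleftrightarrow> max 0 L = 0"
    using lim tendsto_unique[OF trivial_limit_at_right_real lim, of 0] by auto
  then show ?thesis by (simp add: max_def)
qed

theorem theorem2p1:
  fixes \<Omega> :: "(real^'n) set" and t1 t2 :: real
    and f u :: "real^'n \<Rightarrow> real \<Rightarrow> real" and \<psi> :: "real \<Rightarrow> real"
  assumes "open \<Omega>" and "t1 < t2"
    and "continuous_on (\<Omega> \<times> {t1<..<t2}) (\<lambda>(x, t). f x t)"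
    and "\<forall>\<epsilon>>0. \<psi> \<epsilon> > 0"
    and "filterlim \<psi> at_top (at_right 0)"
    and "((\<lambda>\<epsilon>. \<epsilon> * \<psi> \<epsilon>) \<longlongrightarrow> 0) (at_right 0)"
    and "continuous_on (\<Omega> \<times> {t1<..<t2}) (\<lambda>(x, t). u x t)"
    and "convex_in_space \<Omega> t1 t2 u"
  shows "visc_solution \<Omega> t1 t2 f u \<longleftrightarrow> asymp_visc \<Omega> t1 t2 \<psi> f u"
proof -
  \<comment> \<open>The limit is a positive multiple of the root of the determinant minus the time
    derivative plus \<open>f\<close>. That it is nonpositive is the differential inequality at
    minima; that its negative is nonpositive is the one at maxima.\<close>
  have min: "((\<lambda>\<epsilon>. max 0 (- \<phi> x t + M_eps \<psi> f \<epsilon> \<phi> x t) / \<epsilon>\<^sup>2) \<longlongrightarrow> 0) (at_right 0)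
      \<longleftrightarrow> \<phi>t x t - root CARD('n) (det (D2\<phi> x t)) \<ge> f x t"
    and max: "((\<lambda>\<epsilon>. max 0 (\<phi> x t - M_eps \<psi> f \<epsilon> \<phi> x t) / \<epsilon>\<^sup>2) \<longlongrightarrow> 0) (at_right 0)
      \<longleftrightarrow> \<phi>t x t - root CARD('n) (det (D2\<phi> x t)) \<le> f x t"
    if test: "C21_convex_test \<phi> D\<phi> D2\<phi> \<phi>t" for \<phi> D\<phi> D2\<phi> \<phi>t and x :: "real^'n" and t
  proof -
    define c where "c = real CARD('n) / (2 * (real CARD('n) + 2))"
    have c: "c > 0" by (simp add: c_def)
    let ?L = "c * (root CARD('n) (det (D2\<phi> x t)) - \<phi>t x t + f x t)"
    have lim: "((\<lambda>\<epsilon>. (- \<phi> x t + M_eps \<psi> f \<epsilon> \<phi> x t) / \<epsilon>\<^sup>2) \<longlongrightarrow> ?L) (at_right 0)"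
      using M_eps_expansion[OF test assms(5,6,4), of f x t] by (simp add: c_def)
    have lim': "((\<lambda>\<epsilon>. (\<phi> x t - M_eps \<psi> f \<epsilon> \<phi> x t) / \<epsilon>\<^sup>2) \<longlongrightarrow> - ?L) (at_right 0)"
    proof -
      have "(\<phi> x t - M_eps \<psi> f \<epsilon> \<phi> x t) / \<epsilon>\<^sup>2 = - ((- \<phi> x t + M_eps \<psi> f \<epsilon> \<phi> x t) / \<epsilon>\<^sup>2)" for \<epsilon>
        by (simp only: minus_divide_left) simp
      with tendsto_minus[OF lim] show ?thesis by presburger
    qed
    show "((\<lambda>\<epsilon>. max 0 (- \<phi> x t + M_eps \<psi> f \<epsilon> \<phi> x t) / \<epsilon>\<^sup>2) \<longlongrightarrow> 0) (at_right 0)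
        \<longleftrightarrow> \<phi>t x t - root CARD('n) (det (D2\<phi> x t)) \<ge> f x t"
      unfolding tendsto_positive_part_zero_iff[OF lim] using c by (auto simp: mult_le_0_iff)
    show "((\<lambda>\<epsilon>. max 0 (\<phi> x t - M_eps \<psi> f \<epsilon> \<phi> x t) / \<epsilon>\<^sup>2) \<longlongrightarrow> 0) (at_right 0)
        \<longleftrightarrow> \<phi>t x t - root CARD('n) (det (D2\<phi> x t)) \<le> f x t"
      unfolding tendsto_positive_part_zero_iff[OF lim'] using c by (auto simp: zero_le_mult_iff)
  qed
  show ?thesis
    unfolding visc_solution_def asymp_visc_def
  proof (intro ball_cong refl iff_allI imp_cong)
    fix x :: "real^'n" and t and \<phi> :: "real^'n \<Rightarrow> real \<Rightarrow> real" and D\<phi> D2\<phi> \<phi>t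
    assume "C21_convex_test \<phi> D\<phi> D2\<phi> \<phi>t"
    note iffs = min[OF this, of x t] max[OF this, of x t]
    show "((strict_loc_max \<Omega> t1 t2 u \<phi> x t \<and> u x t = \<phi> x t \<longrightarrow>
            \<phi>t x t - root CARD('n) (det (D2\<phi> x t)) \<le> f x t) \<and>
         (strict_loc_min \<Omega> t1 t2 u \<phi> x t \<and> u x t = \<phi> x t \<longrightarrow>
            \<phi>t x t - root CARD('n) (det (D2\<phi> x t)) \<ge> f x t)) =
        ((strict_loc_min \<Omega> t1 t2 u \<phi> x t \<and> u x t = \<phi> x t \<longrightarrow>
            ((\<lambda>\<epsilon>. max 0 (- \<phi> x t + M_eps \<psi> f \<epsilon> \<phi> x t) / \<epsilon>\<^sup>2) \<longlongrightarrow> 0) (at_right 0)) \<and>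
         (strict_loc_max \<Omega> t1 t2 u \<phi> x t \<and> u x t = \<phi> x t \<longrightarrow>
            ((\<lambda>\<epsilon>. max 0 (\<phi> x t - M_eps \<psi> f \<epsilon> \<phi> x t) / \<epsilon>\<^sup>2) \<longlongrightarrow> 0) (at_right 0)))"
      unfolding iffs by blast
  qed
qed

end
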